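(* Let $\mathcal{K}(x,x') = \langle \boldsymbol{\phi}(x), \boldsymbol{\phi}(x') \rangle$ be a kernel on an input set $\Omega$ with feature map $\boldsymbol{\phi}: \Omega \to H$ into a (finite- or infinite-dimensional) real Hilbert space $H$. Let $\mathcal{X} = \{x_1, \ldots, x_n\}$ and $\mathcal{X}' = \{x'_1, \ldots, x'_n\}$ be two lists of points of $\Omega$, and let $\boldsymbol{\Gamma}$, $\tilde{\mathbf{K}}$, $\mathbf{Z}$ and $\mathbf{K}_{\boldsymbol{\Gamma}} = \tilde{\mathbf{K}}^{-1/2} \mathbf{Z} \tilde{\mathbf{K}}^{-1/2} \in \mathbb{R}^{2n \times 2n}$ be defined from them as in the context. Let $(\gamma_j, \mathbf{b}_j)$ be the eigenvalues and orthonormal eigenvectors of the symmetric matrix $\mathbf{K}_{\boldsymbol{\Gamma}}$, indexed in descending eigenvalue order. Let $d \ge 1$ and assume that the $d$ largest eigenvalues of $\boldsymbol{\Gamma}$ are positive and that the $d$-th largest is strictly greater than the $(d+1)$-th largest (if there is one), eigenvalues being counted with multiplicity. Then: (a) All nonzero eigenvalues of $\mathbf{K}_{\boldsymbol{\Gamma}}$ are eigenvalues of $\boldsymbol{\Gamma}$ and vice versa. (b) The top spectral solutions give the embeddings $$\mathbf{f}(x) = \mathbf{U} \tilde{\mathbf{S}} [\mathbf{b}_1 \ \cdots \ \mathbf{b}_d]^\top \tilde{\mathbf{K}}^{-1/2} [\mathbf{K}_{x\mathcal{X}} \ \mathbf{K}_{x\mathcal{X}'}]^\top, \qquad x \in \Omega,$$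 with $\mathbf{U} \in \mathbb{R}^{d \times d}$ an orthogonal matrix, $\tilde{\mathbf{S}} = \mathrm{diag}(\gamma_1^{-1/2}, \ldots, \gamma_d^{-1/2})$, and $\mathbf{K}_{x\mathcal{X}}, \mathbf{K}_{x\mathcal{X}'} \in \mathbb{R}^{1 \times n}$ the row vectors with $[\mathbf{K}_{x\mathcal{X}}]_i = \mathcal{K}(x_i, x)$ and $[\mathbf{K}_{x\mathcal{X}'}]_i = \mathcal{K}(x'_i, x)$. (That is, the functions $x \mapsto \mathbf{W}\boldsymbol{\phi}(x)$ with $\mathbf{W}$ top spectral are exactly the functions of this form, as $\mathbf{U}$ ranges over the orthogonal matrices.) (c) The top spectral solutions correspond to the embeddings $\mathbf{f}$ given by $$\underset{\mathbf{f}}{\mathrm{argmin}} \ \|\mathbf{f}\|_{\mathcal{K}} \quad \text{s.t.} \quad \mathcal{L}(\mathbf{f}) = 0;$$ that is, the set of functions $x \mapsto \mathbf{W}\boldsymbol{\phi}(x)$ with $\mathbf{W}$ top spectral equals the set of minimizers of this problem.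
   Context: Model. Embeddings are functions $\mathbf{f}: \Omega \to \mathbb{R}^d$ of the form $\mathbf{f}(x) = \mathbf{W} \boldsymbol{\phi}(x)$ with $\mathbf{W}: H \to \mathbb{R}^d$ a bounded linear map (a $d \times m$ matrix if $H = \mathbb{R}^m$). Loss. $\mathcal{L}(\mathbf{f}) = \| \mathbf{C} - \mathbf{I}_d \|_F^2$, where $\mathbf{C} = \frac{1}{2n} \sum_{i=1}^n \left( \mathbf{f}(x_i) \mathbf{f}(x'_i)^\top + \mathbf{f}(x'_i) \mathbf{f}(x_i)^\top \right) \in \mathbb{R}^{d \times d}$ and $\|\cdot\|_F$ is the Frobenius norm. Feature cross-correlation. $\boldsymbol{\Gamma} = \frac{1}{2n} \sum_{i=1}^n \left( \boldsymbol{\phi}(x_i) \boldsymbol{\phi}(x'_i)^\top + \boldsymbol{\phi}(x'_i) \boldsymbol{\phi}(x_i)^\top \right)$, a self-adjoint finite-rank operator on $H$, where $\mathbf{u}\mathbf{v}^\top$ denotes the operator $\mathbf{w} \mapsto \langle \mathbf{v}, \mathbf{w} \rangle \mathbf{u}$. So $\mathbf{C} = \mathbf{W} \boldsymbol{\Gamma} \mathbf{W}^\top$. Kernel matrices. $\mathbf{K}_{\mathcal{X}\mathcal{X}} \in \mathbb{R}^{n \times n}$ has entries $\mathcal{K}(x_i, x_j)$; $\mathbf{K}_{\mathcal{X}\mathcal{X}'}$ has entries $\mathcal{K}(x_i, x'_j)$; $\mathbf{K}_{\mathcal{X}'\mathcal{X}}$ has entries $\mathcal{K}(x'_i, x_j)$;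 $\mathbf{K}_{\mathcal{X}'\mathcal{X}'}$ has entries $\mathcal{K}(x'_i, x'_j)$. Then $$\tilde{\mathbf{K}} = \begin{bmatrix} \mathbf{K}_{\mathcal{X}\mathcal{X}} & \mathbf{K}_{\mathcal{X}\mathcal{X}'} \\ \mathbf{K}_{\mathcal{X}'\mathcal{X}} & \mathbf{K}_{\mathcal{X}'\mathcal{X}'} \end{bmatrix}, \qquad \mathbf{Z} = \mathbf{M} + \mathbf{M}^\top, \quad \mathbf{M} = \frac{1}{2n} \begin{bmatrix} \mathbf{K}_{\mathcal{X}\mathcal{X}'} \mathbf{K}_{\mathcal{X}\mathcal{X}} & \mathbf{K}_{\mathcal{X}\mathcal{X}'}^2 \\ \mathbf{K}_{\mathcal{X}'\mathcal{X}'} \mathbf{K}_{\mathcal{X}\mathcal{X}} & \mathbf{K}_{\mathcal{X}'\mathcal{X}'} \mathbf{K}_{\mathcal{X}\mathcal{X}'} \end{bmatrix}.$$ $\tilde{\mathbf{K}}^{-1/2}$ is the inverse of the positive semidefinite square root of $\tilde{\mathbf{K}}$; if $\tilde{\mathbf{K}}$ is singular it means $(\tilde{\mathbf{K}}^{+})^{1/2}$, with $\tilde{\mathbf{K}}^{+}$ the Moore–Penrose pseudoinverse. Top spectral solutions. Let $\mathbf{g}_1, \ldots, \mathbf{g}_d \in H$ be orthonormal eigenvectors of $\boldsymbol{\Gamma}$ for its $d$ largest eigenvalues $\lambda_1 \ge \cdots \ge \lambda_d > 0$ (with multiplicity). A top spectral $\mathbf{W}$ is a map $\mathbf{W} = \mathbf{U}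 \, \mathrm{diag}(\lambda_1^{-1/2}, \ldots, \lambda_d^{-1/2}) \, [\mathbf{g}_1 \ \cdots \ \mathbf{g}_d]^\top$ with $\mathbf{U} \in \mathbb{R}^{d \times d}$ orthogonal, where $[\mathbf{g}_1 \cdots \mathbf{g}_d]^\top$ is the map $\mathbf{w} \mapsto (\langle \mathbf{g}_j, \mathbf{w} \rangle)_{j=1}^d$. Norm. $\|\mathbf{f}\|_{\mathcal{K}}$ is the RKHS norm of the $\mathbb{R}^d$-valued function $\mathbf{f} = (f_1, \ldots, f_d)$ with respect to $\mathcal{K}$: $\|\mathbf{f}\|_{\mathcal{K}}^2 = \sum_{j=1}^d \|f_j\|_{\mathcal{K}}^2$ with $\|f_j\|_{\mathcal{K}}$ the usual scalar RKHS norm; equivalently, $\|\mathbf{f}\|_{\mathcal{K}}$ is the minimal Frobenius (Hilbert–Schmidt) norm of a $\mathbf{W}$ with $\mathbf{f}(x) = \mathbf{W}\boldsymbol{\phi}(x)$ for all $x \in \Omega$. The minimization in (c) is over functions $\mathbf{f}$ whose components lie in the RKHS of $\mathcal{K}$. *)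

theory Defs
  imports "HOL-Analysis.Analysis" "HOL-Library.Extended_Nat"
begin

section \<open>Eigenvalues, listed with multiplicity\<close>

definition eigenvalue :: "('h::real_vector \<Rightarrow> 'h) \<Rightarrow> real \<Rightarrow> bool" where
  "eigenvalue T l \<longleftrightarrow> (\<exists>v. v \<noteq> 0 \<and> T v = l *\<^sub>R v)"

definition eigenspace :: "('h::real_vector \<Rightarrow> 'h) \<Rightarrow> real \<Rightarrow> 'h set" where
  "eigenspace T l = {v. T v = l *\<^sub>R v}"

text \<open>The case distinction is needed because \<^const>\<open>dim\<close> is 0 on infinite-dimensional
  subspaces; the eigenvalue 0 of a finite-rank operator may have infinite multiplicity.\<close>

definition multiplicity_of :: "('h::real_vector \<Rightarrow> 'h) \<Rightarrow> real \<Rightarrow> enat" where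
  "multiplicity_of T l =
     (if \<exists>B. finite B \<and> eigenspace T l \<subseteq> span B then enat (dim (eigenspace T l)) else \<infinity>)"

text \<open>\<open>lam 1 \<ge> \<dots> \<ge> lam k\<close> are the \<open>k\<close> largest eigenvalues of \<open>T\<close>, counted with multiplicity:
  no number is listed more often than its multiplicity (so only eigenvalues are listed), and
  every number above some listed one is listed as often as its multiplicity.
  No such list exists if \<open>T\<close> has fewer than \<open>k\<close> eigenvalues.\<close>

definition largest_eigenvalues ::
    "('h::real_vector \<Rightarrow> 'h) \<Rightarrow> nat \<Rightarrow> (nat \<Rightarrow> real) \<Rightarrow> bool" where
  "largest_eigenvalues T k lam \<longleftrightarrow>
     (\<forall>i\<in>{1..k}. \<forall>j\<in>{1..k}. i \<le> j \<longrightarrow> lam j \<le> lam i) \<and>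
     (\<forall>l. enat (card {j \<in> {1..k}. lam j = l}) \<le> multiplicity_of T l) \<and>
     (\<forall>l. (\<exists>j\<in>{1..k}. lam j < l) \<longrightarrow>
            multiplicity_of T l \<le> enat (card {j \<in> {1..k}. lam j = l}))"

definition orthonormal_family :: "nat \<Rightarrow> (nat \<Rightarrow> 'h::real_inner) \<Rightarrow> bool" where
  "orthonormal_family k g \<longleftrightarrow>
     (\<forall>i\<in>{1..k}. \<forall>j\<in>{1..k}. g i \<bullet> g j = (if i = j then 1 else 0))"

section \<open>Matrices\<close>

definition diag :: "('d \<Rightarrow> real) \<Rightarrow> real^'d^'d" where
  "diag v = (\<chi> i j. if i = j then v i else 0)"

definition block_matrix ::
    "real^'n^'n \<Rightarrow> real^'n^'n \<Rightarrow> real^'n^'n \<Rightarrow> real^'n^'n \<Rightarrow> real^('n + 'n)^('n + 'n)" where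
  "block_matrix A B C D = (\<chi> p q.
     (case p of
        Inl i \<Rightarrow> (case q of Inl j \<Rightarrow> A $ i $ j | Inr j \<Rightarrow> B $ i $ j)
      | Inr i \<Rightarrow> (case q of Inl j \<Rightarrow> C $ i $ j | Inr j \<Rightarrow> D $ i $ j)))"

definition psd :: "real^'m^'m \<Rightarrow> bool" where
  "psd A \<longleftrightarrow> transpose A = A \<and> (\<forall>v. 0 \<le> v \<bullet> (A *v v))"

definition psd_sqrt :: "real^'m^'m \<Rightarrow> real^'m^'m" where
  "psd_sqrt A = (THE B. psd B \<and> B ** B = A)"

definition moore_penrose :: "real^'m^'m \<Rightarrow> real^'m^'m" where
  "moore_penrose A = (THE X. A ** X ** A = A \<and> X ** A ** X = X \<and>
     transpose (A ** X) = A ** X \<and> transpose (X ** A) = X ** A)"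

definition inverse_sqrt :: "real^'m^'m \<Rightarrow> real^'m^'m" where
  "inverse_sqrt A =
     (if invertible A then matrix_inv (psd_sqrt A) else psd_sqrt (moore_penrose A))"

section \<open>Kernel matrices\<close>

text \<open>The lists \<open>x\<^sub>1, \<dots>, x\<^sub>n\<close> are families over a finite type \<open>'n\<close> with \<open>n = CARD('n)\<close>;
  the index set of the \<open>2n\<close>-dimensional blocks is \<open>'n + 'n\<close>.\<close>

definition kernel_matrix ::
    "('x \<Rightarrow> 'x \<Rightarrow> real) \<Rightarrow> ('n \<Rightarrow> 'x) \<Rightarrow> ('n \<Rightarrow> 'x) \<Rightarrow> real^'n^'n" where
  "kernel_matrix K y z = (\<chi> i j. K (y i) (z j))"

definition K_tilde ::
    "('x \<Rightarrow> 'x \<Rightarrow> real) \<Rightarrow> ('n::finite \<Rightarrow> 'x) \<Rightarrow> ('n \<Rightarrow> 'x) \<Rightarrow> real^('n + 'n)^('n + 'n)" where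
  "K_tilde K x x' = block_matrix
     (kernel_matrix K x x) (kernel_matrix K x x')
     (kernel_matrix K x' x) (kernel_matrix K x' x')"

definition M_mat ::
    "('x \<Rightarrow> 'x \<Rightarrow> real) \<Rightarrow> ('n::finite \<Rightarrow> 'x) \<Rightarrow> ('n \<Rightarrow> 'x) \<Rightarrow> real^('n + 'n)^('n + 'n)" where
  "M_mat K x x' = (1 / (2 * real CARD('n))) *\<^sub>R block_matrix
     (kernel_matrix K x x' ** kernel_matrix K x x)
     (kernel_matrix K x x' ** kernel_matrix K x x')
     (kernel_matrix K x' x' ** kernel_matrix K x x)
     (kernel_matrix K x' x' ** kernel_matrix K x x')"

definition Z_mat ::
    "('x \<Rightarrow> 'x \<Rightarrow> real) \<Rightarrow> ('n::finite \<Rightarrow> 'x) \<Rightarrow> ('n \<Rightarrow> 'x) \<Rightarrow> real^('n + 'n)^('n + 'n)" where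
  "Z_mat K x x' = M_mat K x x' + transpose (M_mat K x x')"

definition K_Gamma ::
    "('x \<Rightarrow> 'x \<Rightarrow> real) \<Rightarrow> ('n::finite \<Rightarrow> 'x) \<Rightarrow> ('n \<Rightarrow> 'x) \<Rightarrow> real^('n + 'n)^('n + 'n)" where
  "K_Gamma K x x' =
     inverse_sqrt (K_tilde K x x') ** Z_mat K x x' ** inverse_sqrt (K_tilde K x x')"

definition kernel_vector ::
    "('x \<Rightarrow> 'x \<Rightarrow> real) \<Rightarrow> ('n::finite \<Rightarrow> 'x) \<Rightarrow> ('n \<Rightarrow> 'x) \<Rightarrow> 'x \<Rightarrow> real^('n + 'n)" where
  "kernel_vector K x x' a = (\<chi> p. (case p of Inl i \<Rightarrow> K (x i) a | Inr i \<Rightarrow> K (x' i) a))"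

section \<open>Loss and feature cross-correlation\<close>

definition outer_op :: "'h::real_inner \<Rightarrow> 'h \<Rightarrow> 'h \<Rightarrow> 'h" where
  "outer_op u v = (\<lambda>w. (v \<bullet> w) *\<^sub>R u)"

definition outer_mat :: "real^'d \<Rightarrow> real^'d \<Rightarrow> real^'d^'d" where
  "outer_mat u v = (\<chi> i j. u $ i * v $ j)"

definition feature_cross_corr ::
    "('x \<Rightarrow> 'h::real_inner) \<Rightarrow> ('n::finite \<Rightarrow> 'x) \<Rightarrow> ('n \<Rightarrow> 'x) \<Rightarrow> 'h \<Rightarrow> 'h" where
  "feature_cross_corr \<phi> x x' = (\<lambda>w. (1 / (2 * real CARD('n))) *\<^sub>R
     (\<Sum>i\<in>UNIV. outer_op (\<phi> (x i)) (\<phi> (x' i)) w + outer_op (\<phi> (x' i)) (\<phi> (x i)) w))"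

definition embedding_cross_corr ::
    "('n::finite \<Rightarrow> 'x) \<Rightarrow> ('n \<Rightarrow> 'x) \<Rightarrow> ('x \<Rightarrow> real^'d) \<Rightarrow> real^'d^'d" where
  "embedding_cross_corr x x' f = (1 / (2 * real CARD('n))) *\<^sub>R
     (\<Sum>i\<in>UNIV. outer_mat (f (x i)) (f (x' i)) + outer_mat (f (x' i)) (f (x i)))"

text \<open>\<^const>\<open>norm\<close> on \<open>real^'d^'d\<close> is the Frobenius norm.\<close>

definition loss :: "('n::finite \<Rightarrow> 'x) \<Rightarrow> ('n \<Rightarrow> 'x) \<Rightarrow> ('x \<Rightarrow> real^'d) \<Rightarrow> real" where
  "loss x x' f = (norm (embedding_cross_corr x x' f - mat 1))\<^sup>2"

section \<open>Top spectral solutions\<close>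

text \<open>The coordinates of \<open>real^'d\<close> are numbered \<open>1, \<dots>, d\<close> by a bijection \<open>idx\<close>, which relates
  them to the descending enumerations of eigenvalues.\<close>

definition top_spectral ::
    "('d::finite \<Rightarrow> nat) \<Rightarrow> ('h::real_inner \<Rightarrow> 'h) \<Rightarrow> (nat \<Rightarrow> real) \<Rightarrow> ('h \<Rightarrow> real^'d) \<Rightarrow> bool" where
  "top_spectral idx T lam W \<longleftrightarrow>
     largest_eigenvalues T CARD('d) lam \<and> (\<forall>j\<in>{1..CARD('d)}. 0 < lam j) \<and>
     (\<exists>g U. orthonormal_family CARD('d) g \<and>
            (\<forall>j\<in>{1..CARD('d)}. T (g j) = lam j *\<^sub>R g j) \<and>
            orthogonal_matrix U \<and>
            W = (\<lambda>w. (U ** diag (\<lambda>i. lam (idx i) powr (-1/2))) *v (\<chi> i. g (idx i) \<bullet> w)))"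

section \<open>Reproducing kernel Hilbert space\<close>

text \<open>\<open>F\<close> with inner product \<open>ip\<close> is a Hilbert space of real functions with reproducing kernel
  \<open>K\<close>. By the Moore--Aronszajn theorem there is exactly one for a given kernel
  (\<open>ip\<close> being determined on \<open>F\<close> only).\<close>

locale rkhs =
  fixes K :: "'x \<Rightarrow> 'x \<Rightarrow> real"
    and F :: "('x \<Rightarrow> real) set"
    and ip :: "('x \<Rightarrow> real) \<Rightarrow> ('x \<Rightarrow> real) \<Rightarrow> real"
  assumes zero_mem: "(\<lambda>a. 0) \<in> F"
    and add_mem: "\<lbrakk>f \<in> F; g \<in> F\<rbrakk> \<Longrightarrow> (\<lambda>a. f a + g a) \<in> F"
    and scale_mem: "f \<in> F \<Longrightarrow> (\<lambda>a. c * f a) \<in> F"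
    and ip_commute: "\<lbrakk>f \<in> F; g \<in> F\<rbrakk> \<Longrightarrow> ip f g = ip g f"
    and ip_add: "\<lbrakk>f \<in> F; g \<in> F; h \<in> F\<rbrakk> \<Longrightarrow> ip (\<lambda>a. f a + g a) h = ip f h + ip g h"
    and ip_scale: "\<lbrakk>f \<in> F; h \<in> F\<rbrakk> \<Longrightarrow> ip (\<lambda>a. c * f a) h = c * ip f h"
    and ip_nonneg: "f \<in> F \<Longrightarrow> 0 \<le> ip f f"
    and ip_definite: "\<lbrakk>f \<in> F; ip f f = 0\<rbrakk> \<Longrightarrow> f = (\<lambda>a. 0)"
    and complete: "\<lbrakk>\<And>n. s n \<in> F;
        \<And>e. 0 < e \<Longrightarrow> \<exists>N. \<forall>m\<ge>N. \<forall>n\<ge>N. sqrt (ip (\<lambda>a. s m a - s n a) (\<lambda>a. s m a - s n a)) < e\<rbrakk>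
      \<Longrightarrow> \<exists>f\<in>F. (\<lambda>n. sqrt (ip (\<lambda>a. s n a - f a) (\<lambda>a. s n a - f a))) \<longlonglongrightarrow> 0"
    and kernel_mem: "(\<lambda>a. K a b) \<in> F"
    and reproducing: "f \<in> F \<Longrightarrow> ip f (\<lambda>a. K a b) = f b"

definition vector_rkhs_norm ::
    "(('x \<Rightarrow> real) \<Rightarrow> ('x \<Rightarrow> real) \<Rightarrow> real) \<Rightarrow> ('x \<Rightarrow> real^'d) \<Rightarrow> real" where
  "vector_rkhs_norm ip f = sqrt (\<Sum>j\<in>UNIV. ip (\<lambda>a. f a $ j) (\<lambda>a. f a $ j))"

end

theory Submission
  imports Defs
begin

text \<open>Let \<open>\<Phi> c = \<Sum>\<^sub>p c\<^sub>p \<phi>(x\<^sub>p)\<close> be the synthesis map of the \<open>2n\<close> sample points, so that the Gram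
  matrix \<open>K~\<close> is \<open>\<Phi>\<^sup>T \<Phi>\<close>, and let \<open>J\<close> be \<open>1/(2n)\<close> times the swap of the two blocks. Then
  \<open>\<Gamma> = \<Phi> J \<Phi>\<^sup>T\<close>, \<open>Z = K~ J K~\<close> and \<open>K\<^sub>\<Gamma> = R J R\<close>, where \<open>R\<close> is the square root of \<open>K~\<close> and \<open>S\<close>
  its pseudoinverse. The partial isometry \<open>V = \<Phi> S\<close> intertwines \<open>K\<^sub>\<Gamma>\<close> and \<open>\<Gamma>\<close> and is isometric from
  the range of \<open>R\<close> onto the range of \<open>\<Phi>\<close>. Hence it identifies the eigenspaces for nonzero
  eigenvalues, and by the gap condition two orthonormal families of top eigenvectors differ by an
  orthogonal matrix that commutes with \<open>diag(\<lambda>)\<close>.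

  For the minimization, project the components of a feasible \<open>f\<close> orthogonally onto the span of the
  kernel sections at the sample points. This does not change the loss, and the projections
  correspond isometrically to vectors \<open>u\<^sub>j = S f\<^sub>j(samples)\<close>, in terms of which the constraint reads
  \<open>u\<^sub>j \<bullet> K\<^sub>\<Gamma> u\<^sub>k = \<delta>\<^sub>j\<^sub>k\<close>. In the eigenbasis of \<open>K\<^sub>\<Gamma>\<close> it remains to minimize the Frobenius norm of \<open>A\<close>
  subject to \<open>A diag(\<gamma>) A\<^sup>T = I\<close>.\<close>

section \<open>Spectral calculus of symmetric matrices\<close>

lemma inner_matrix_vector_left:
  fixes A :: "real^'m^'n"
  shows "(A *v x) \<bullet> y = x \<bullet> (transpose A *v y)"
  by (metis dot_lmul_matrix vector_transpose_matrix)

text \<open>The residual of the expansion is orthogonal to every \<open>e i\<close>; these are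
  independent and as many as the dimension, so it is orthogonal to itself. A general index set
  \<open>I\<close> covers both \<open>UNIV\<close> and \<open>{1..2 * CARD('n)}\<close>.\<close>

lemma orthonormal_expansion:
  fixes e :: "'i \<Rightarrow> 'a::euclidean_space"
  assumes I: "finite I" "card I = DIM('a)"
    and e: "\<And>i j. \<lbrakk>i \<in> I; j \<in> I\<rbrakk> \<Longrightarrow> e i \<bullet> e j = (if i = j then 1 else 0)"
  shows "v = (\<Sum>i\<in>I. (v \<bullet> e i) *\<^sub>R e i)"
proof -
  have inj: "inj_on e I"
    using e by (metis inj_onI zero_neq_one)
  have "independent (e ` I)"
  proof (rule pairwise_orthogonal_independent)
    show "pairwise orthogonal (e ` I)"
      by (auto simp: pairwise_def orthogonal_def e)
    show "0 \<notin> e ` I"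
      using e by (metis imageE inner_zero_left zero_neq_one)
  qed
  then have span: "span (e ` I) = UNIV"
    by (metis I(2) card_eq_dim card_image dim_UNIV independent_imp_finite inj subset_UNIV
        top.extremum_uniqueI)
  define w where "w = v - (\<Sum>i\<in>I. (v \<bullet> e i) *\<^sub>R e i)"
  have "orthogonal w y" if "y \<in> e ` I" for y
  proof -
    obtain k where k: "k \<in> I" "y = e k"
      using \<open>y \<in> e ` I\<close> by blast
    have "(\<Sum>i\<in>I. (v \<bullet> e i) * (e i \<bullet> e k)) = (\<Sum>i\<in>I. if i = k then v \<bullet> e i else 0)"
      using e k by (intro sum.cong) auto
    then show ?thesis
      using k I by (simp add: w_def orthogonal_def inner_diff_left inner_sum_left)
  qed
  then have "orthogonal w w"
    using orthogonal_to_span[of w "e ` I" w] span by blast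
  then show ?thesis
    by (simp add: w_def orthogonal_def)
qed

text \<open>A maximizer \<open>v\<close> of the Rayleigh quotient on the unit sphere of
  \<open>S\<close> is an eigenvector: the residual \<open>w = A v - l v\<close> stays in
  \<open>S\<close>, and moving from \<open>v\<close> towards \<open>w\<close> would raise the
  quotient unless \<open>w = 0\<close>.\<close>

lemma symmetric_eigenvector_in_subspace:
  fixes A :: "real^'m^'m"
  assumes A: "transpose A = A" and S: "subspace S" "S \<noteq> {0}"
    and inv: "\<And>v. v \<in> S \<Longrightarrow> A *v v \<in> S"
  obtains v l where "v \<in> S" "norm v = 1" "A *v v = l *\<^sub>R v"
proof -
  obtain s where s: "s \<in> S" "s \<noteq> 0"
    using S subspace_0 by blast
  let ?q = "\<lambda>v. v \<bullet> (A *v v)"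
  have "compact (S \<inter> sphere 0 1)"
    using S closed_subspace by (intro closed_Int_compact) auto
  moreover have "(1 / norm s) *\<^sub>R s \<in> S \<inter> sphere 0 1"
    using s S subspace_scale by auto
  moreover have "continuous_on (S \<inter> sphere 0 1) ?q"
    by (intro continuous_intros linear_continuous_on matrix_vector_mul_bounded_linear)
  ultimately obtain v where v: "v \<in> S" "norm v = 1"
    and max: "\<And>u. \<lbrakk>u \<in> S; norm u = 1\<rbrakk> \<Longrightarrow> ?q u \<le> ?q v"
    using continuous_attains_sup[of "S \<inter> sphere 0 1" ?q]
    by (metis IntE IntI dist_0_norm emptyE mem_sphere)
  define l where "l = ?q v"
  have le: "?q u \<le> l * (u \<bullet> u)" if "u \<in> S" for u
  proof (cases "u = 0")
    case False
    have "?q ((1 / norm u) *\<^sub>R u) \<le> l"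
      unfolding l_def using False S that subspace_scale by (intro max) auto
    then show ?thesis
      using False by (simp add: matrix_vector_mult_scaleR field_simps power2_norm_eq_inner
          flip: power2_eq_square)
  qed simp
  define w where "w = A *v v - l *\<^sub>R v"
  have wS: "w \<in> S"
    unfolding w_def by (intro subspace_diff subspace_scale S inv v)
  have vv: "v \<bullet> v = 1"
    using v by (simp add: norm_eq_1)
  have wv: "w \<bullet> v = 0"
    by (simp add: w_def inner_diff_left inner_diff_right vv l_def inner_commute)
  have wAv: "w \<bullet> (A *v v) = w \<bullet> w"
    using wv by (simp add: w_def inner_diff_right)
  then have vAw: "v \<bullet> (A *v w) = w \<bullet> w"
    using A by (metis inner_commute inner_matrix_vector_left)
  let ?c = "l * (w \<bullet> w) - ?q w"
  \<comment> \<open>The bound \<open>le\<close> at \<open>v + t w\<close>: the terms of order 0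
    cancel, and what is left is divided by \<open>t\<close>.\<close>
  have small: "2 * (w \<bullet> w) \<le> t * ?c" if "t > 0" for t
  proof -
    have "v + t *\<^sub>R w \<in> S"
      by (intro subspace_add subspace_scale S v wS)
    from le[OF this] have "l + 2 * t * (w \<bullet> w) + t * t * ?q w \<le> l + t * t * (l * (w \<bullet> w))"
      using wv by (simp add: matrix_vector_right_distrib matrix_vector_mult_scaleR inner_add
          wAv vAw vv inner_commute[of v w] algebra_simps flip: l_def)
    then have "t * (2 * (w \<bullet> w)) \<le> t * (t * ?c)"
      by (simp add: algebra_simps)
    then show ?thesis
      using that by simp
  qed
  have "w = 0"
  proof (rule ccontr)
    assume "w \<noteq> 0"
    then have pos: "w \<bullet> w > 0" by simp
    \<comment> \<open>This \<open>t\<close> makes the right-hand side at most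
      \<open>w \<bullet> w\<close>, half of the left-hand side.\<close>
    have "2 * (w \<bullet> w) \<le> (w \<bullet> w) / (\<bar>?c\<bar> + 1) * ?c"
      using pos by (intro small) (simp add: field_simps)
    also have "\<dots> \<le> (w \<bullet> w) / (\<bar>?c\<bar> + 1) * (\<bar>?c\<bar> + 1)"
      using pos by (intro mult_left_mono) auto
    also have "\<dots> = w \<bullet> w"
      by (simp add: field_simps)
    finally show False
      using pos by simp
  qed
  then show ?thesis
    using that v by (auto simp: w_def)
qed

text \<open>Induction on the dimension: split off a unit eigenvector \<open>v\<close>; by symmetry
  \<open>A\<close> maps the part of \<open>S\<close> orthogonal to \<open>v\<close> into itself.
  Stating this for invariant subspaces is what lets the induction run.\<close>

lemma symmetric_eigenbasis_of_subspace:
  fixes A :: "real^'m^'m"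
  assumes A: "transpose A = A" and "subspace S" and "\<And>v. v \<in> S \<Longrightarrow> A *v v \<in> S"
  shows "\<exists>B\<subseteq>S. pairwise orthogonal B \<and> (\<forall>v\<in>B. norm v = 1 \<and> (\<exists>l. A *v v = l *\<^sub>R v)) \<and> span B = S"
  using assms(2,3)
proof (induction "dim S" arbitrary: S rule: less_induct)
  case less
  show ?case
  proof (cases "S = {0}")
    case True
    then show ?thesis by (intro exI[of _ "{}"]) auto
  next
    case False
    obtain v l where v: "v \<in> S" "norm v = 1" "A *v v = l *\<^sub>R v"
      using symmetric_eigenvector_in_subspace[OF A less.prems(1) False less.prems(2)] by blast
    have vv: "v \<bullet> v = 1"
      using v by (simp add: norm_eq_1)
    define S' where "S' = {u \<in> S. v \<bullet> u = 0}"
    have sub: "subspace S'"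
      using less.prems(1) by (auto simp: S'_def subspace_def inner_add_right)
    moreover have inv: "A *v u \<in> S'" if "u \<in> S'" for u
      using that less.prems(2) inner_matrix_vector_left[of A v u] v A by (auto simp: S'_def)
    moreover have "dim S' < dim S"
    proof (rule dim_psubset)
      show "span S' \<subset> span S"
        using v vv less.prems(1) sub
        by (simp add: span_eq_iff[THEN iffD2] psubset_eq) (force simp: S'_def)
    qed
    ultimately obtain B where B: "B \<subseteq> S'" "pairwise orthogonal B"
      "\<forall>v\<in>B. norm v = 1 \<and> (\<exists>l. A *v v = l *\<^sub>R v)" "span B = S'"
      using less.hyps[of S'] by auto
    show ?thesis
    proof (intro exI[of _ "insert v B"] conjI)
      show "insert v B \<subseteq> S"
        using B v by (auto simp: S'_def)
      show "pairwise orthogonal (insert v B)"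
        using B by (auto simp: pairwise_insert orthogonal_def S'_def inner_commute)
      show "\<forall>v\<in>insert v B. norm v = 1 \<and> (\<exists>l. A *v v = l *\<^sub>R v)"
        using B v by blast
      have "u \<in> span (insert v B)" if "u \<in> S" for u
      proof -
        have "u - (v \<bullet> u) *\<^sub>R v \<in> S'"
          using that v less.prems(1) vv
          by (auto simp: S'_def inner_diff_right subspace_diff subspace_scale)
        then show ?thesis
          using B(4) span_breakdown_eq by blast
      qed
      then show "span (insert v B) = S"
        using \<open>insert v B \<subseteq> S\<close> less.prems(1) by (meson span_minimal subsetI subset_antisym)
    qed
  qed
qed

theorem symmetric_matrix_eigenbasis:
  fixes A :: "real^'m^'m"
  assumes A: "transpose A = A"
  obtains e :: "'m \<Rightarrow> real^'m" and c
  where "\<And>i j. e i \<bullet> e j = (if i = j then 1 else 0)" and "\<And>i. A *v e i = c i *\<^sub>R e i"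
proof -
  obtain B where B: "pairwise orthogonal B" "\<forall>v\<in>B. norm v = 1 \<and> (\<exists>l. A *v v = l *\<^sub>R v)"
    and span: "span B = UNIV"
    using symmetric_eigenbasis_of_subspace[OF A subspace_UNIV] by blast
  have "independent B"
    using B by (intro pairwise_orthogonal_independent) auto
  then have "finite B" "card B = CARD('m)"
    using span dim_eq_card[of B UNIV] by (auto simp: independent_imp_finite)
  then obtain e where e: "bij_betw e (UNIV :: 'm set) B"
    by (metis finite bij_betw_iff_card)
  have "e i \<bullet> e j = (if i = j then 1 else 0)" for i j
  proof (cases "i = j")
    case True
    then show ?thesis
      using e B(2) by (metis UNIV_I bij_betwE norm_eq_1)
  next
    case False
    then have "e i \<noteq> e j" "e i \<in> B" "e j \<in> B"
      using e by (auto simp: bij_betw_def inj_on_def)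
    then show ?thesis
      using B(1) False by (simp add: pairwise_def orthogonal_def)
  qed
  moreover have "\<forall>i. \<exists>l. A *v e i = l *\<^sub>R e i"
    using B(2) e by (auto simp: bij_betw_def)
  then obtain c where "\<And>i. A *v e i = c i *\<^sub>R e i"
    by metis
  ultimately show ?thesis
    using that by blast
qed

text \<open>For orthonormal \<open>e\<close> this is the symmetric matrix with eigenpairs
  \<open>(c i, e i)\<close>. Fixing \<open>e\<close> and varying \<open>c\<close> turns products,
  square roots and pseudoinverses into pointwise operations on \<open>c\<close>.\<close>

definition spectral_matrix :: "('m \<Rightarrow> real^'m) \<Rightarrow> ('m \<Rightarrow> real) \<Rightarrow> real^'m^'m" where
  "spectral_matrix e c = (\<chi> p q. \<Sum>i\<in>UNIV. c i * (e i $ p * e i $ q))"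

lemma transpose_spectral_matrix [simp]:
  "transpose (spectral_matrix e c) = spectral_matrix e c"
  by (simp add: spectral_matrix_def transpose_def mult_ac)

context
  fixes e :: "'m::finite \<Rightarrow> real^'m"
  assumes orthonormal: "\<And>i j. e i \<bullet> e j = (if i = j then 1 else 0)"
begin

lemma spectral_matrix_eigenvector: "spectral_matrix e c *v e k = c k *\<^sub>R e k"
proof -
  have "spectral_matrix e c *v v = (\<Sum>i\<in>UNIV. (c i * (e i \<bullet> v)) *\<^sub>R e i)" for v
    by (simp add: vec_eq_iff spectral_matrix_def matrix_vector_mult_def inner_vec_def
        sum_distrib_left sum_distrib_right mult_ac) (subst sum.swap, simp)
  then have "spectral_matrix e c *v e k = (\<Sum>i\<in>UNIV. if i = k then c i *\<^sub>R e i else 0)"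
    by (simp add: orthonormal if_distrib[of "\<lambda>t. _ * t"] if_distrib[of "\<lambda>t. t *\<^sub>R _"] cong: if_cong)
  then show ?thesis by simp
qed

lemma matrix_eq_on_basis:
  fixes A B :: "real^'m^'m"
  assumes "\<And>i. A *v e i = B *v e i"
  shows "A = B"
proof -
  have "A *v v = B *v v" for v
    by (subst (1 2) orthonormal_expansion[of UNIV e v])
      (simp_all add: orthonormal assms matrix_vector_mult_scaleR vec.sum)
  then show ?thesis
    using matrix_eq by blast
qed

lemma spectral_matrix_mult:
  "spectral_matrix e c ** spectral_matrix e c' = spectral_matrix e (\<lambda>i. c i * c' i)"
  by (rule matrix_eq_on_basis)
    (simp add: spectral_matrix_eigenvector matrix_vector_mult_scaleR flip: matrix_vector_mul_assoc)

lemma spectral_matrix_one: "spectral_matrix e (\<lambda>i. 1) = mat 1"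
  by (rule matrix_eq_on_basis) (simp add: spectral_matrix_eigenvector)

lemma psd_spectral_matrix:
  assumes "\<And>i. 0 \<le> c i"
  shows "psd (spectral_matrix e c)"
proof -
  let ?D = "spectral_matrix e (\<lambda>i. sqrt (c i))"
  have "spectral_matrix e c = ?D ** ?D"
    by (simp add: spectral_matrix_mult assms)
  moreover have "v \<bullet> (?D ** ?D *v v) = (?D *v v) \<bullet> (?D *v v)" for v
    by (simp add: inner_matrix_vector_left flip: matrix_vector_mul_assoc)
  ultimately show ?thesis
    by (metis inner_ge_zero psd_def transpose_spectral_matrix)
qed

end

section \<open>Square roots and pseudoinverses of positive semidefinite matrices\<close>

lemma psd_eigenbasis:
  fixes A :: "real^'m^'m"
  assumes "psd A"
  obtains e :: "'m \<Rightarrow> real^'m" and c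
  where "\<And>i j. e i \<bullet> e j = (if i = j then 1 else 0)" and "\<And>i. 0 \<le> c i"
    and "A = spectral_matrix e c"
proof -
  obtain e :: "'m \<Rightarrow> real^'m" and c where e: "\<And>i j. e i \<bullet> e j = (if i = j then 1 else 0)"
    and c: "\<And>i. A *v e i = c i *\<^sub>R e i"
    using symmetric_matrix_eigenbasis[of A] assms psd_def by blast
  have "0 \<le> c i" for i
    using assms e[of i i] c[of i] unfolding psd_def by (metis inner_scaleR_right mult.right_neutral)
  moreover have "A = spectral_matrix e c"
    by (rule matrix_eq_on_basis[OF e]) (simp_all add: c spectral_matrix_eigenvector[OF e])
  ultimately show ?thesis
    using that e by blast
qed

text \<open>Let \<open>e i\<close> be an eigenvector of \<open>C\<close> for \<open>c i\<close>. As
  \<open>B\<close> and \<open>C\<close> have the same square, \<open>y = B e i - c i e i\<close>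
  satisfies \<open>B y = - c i y\<close>, which positivity of \<open>B\<close> allows only for
  \<open>y = 0\<close> or \<open>c i = 0\<close>; in the latter case \<open>B e i\<close> has norm
  0.\<close>

lemma psd_sqrt_unique:
  assumes B: "psd B" and C: "psd C" and eq: "B ** B = C ** C"
  shows "B = C"
proof -
  obtain e c where e: "\<And>i j. e i \<bullet> e j = (if i = j then 1 else 0)" and c: "\<And>i. 0 \<le> c i"
    and Ce: "C = spectral_matrix e c"
    using psd_eigenbasis[OF C] by blast
  have "B *v e i = C *v e i" for i
  proof -
    have BB: "B *v (B *v e i) = (c i * c i) *\<^sub>R e i"
      by (simp add: eq Ce spectral_matrix_mult[OF e] spectral_matrix_eigenvector[OF e]
          matrix_vector_mul_assoc)
    define y where "y = B *v e i - c i *\<^sub>R e i"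
    have By: "B *v y = - c i *\<^sub>R y"
      by (simp add: y_def BB matrix_vector_mult_diff_distrib matrix_vector_mult_scaleR algebra_simps)
    have y0: "y = 0"
    proof (cases "c i = 0")
      case True
      then have "(B *v e i) \<bullet> (B *v e i) = 0"
        using B BB by (simp add: inner_matrix_vector_left psd_def)
      then show ?thesis
        using True by (simp add: y_def)
    next
      case False
      have "0 \<le> y \<bullet> (B *v y)"
        using B psd_def by blast
      then have "c i * (y \<bullet> y) \<le> 0"
        by (simp add: By)
      then show ?thesis
        using False c[of i] inner_ge_zero[of y] by (auto simp: mult_le_0_iff)
    qed
    then show ?thesis
      by (simp add: y_def Ce spectral_matrix_eigenvector[OF e])
  qed
  then show ?thesis
    by (rule matrix_eq_on_basis[OF e])
qed

lemma psd_sqrt_eqI: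
  assumes "psd B" and "B ** B = A"
  shows "psd_sqrt A = B"
  unfolding psd_sqrt_def by (rule the_equality) (use assms psd_sqrt_unique in auto)

text \<open>For two solutions \<open>X\<close> and \<open>Y\<close>, the products \<open>A X\<close>
  and \<open>A Y\<close> are both the orthogonal projection onto the range of \<open>A\<close>, and
  likewise \<open>X A = Y A\<close>; hence \<open>Y = Y A Y = X A X = X\<close>.\<close>

lemma moore_penrose_eqI:
  assumes X: "A ** X ** A = A" "X ** A ** X = X"
    "transpose (A ** X) = A ** X" "transpose (X ** A) = X ** A"
  shows "moore_penrose A = X"
  unfolding moore_penrose_def
proof (rule the_equality)
  fix Y
  assume "A ** Y ** A = A \<and> Y ** A ** Y = Y \<and>
     transpose (A ** Y) = A ** Y \<and> transpose (Y ** A) = Y ** A"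
  then have Y: "A ** Y ** A = A" "Y ** A ** Y = Y"
    "transpose (A ** Y) = A ** Y" "transpose (Y ** A) = Y ** A"
    by auto
  have "A ** Y = transpose ((A ** X) ** (A ** Y))"
    using X(1) Y(3) by (simp add: matrix_mul_assoc)
  also have "\<dots> = A ** X"
    using Y(1) X(3) Y(3) by (simp add: matrix_transpose_mul matrix_mul_assoc)
  finally have 1: "A ** Y = A ** X" .
  have "Y ** A = transpose ((Y ** A) ** (X ** A))"
    using Y(4) by (metis X(1) matrix_mul_assoc)
  also have "\<dots> = (X ** A) ** (Y ** A)"
    by (subst matrix_transpose_mul) (simp only: X(4) Y(4))
  also have "\<dots> = X ** (A ** Y ** A)"
    by (simp only: matrix_mul_assoc)
  also have "\<dots> = X ** A"
    by (simp only: Y(1))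
  finally have 2: "Y ** A = X ** A" .
  show "Y = X"
    by (metis 1 2 X(2) Y(2) matrix_mul_assoc)
qed (use X in auto)

text \<open>Since \<open>1 / 0 = 0\<close>, one formula serves both the invertible and the singular
  case of \<open>inverse_sqrt\<close>.\<close>

lemma inverse_sqrt_spectral_matrix:
  fixes e :: "'m::finite \<Rightarrow> real^'m"
  assumes e: "\<And>i j. e i \<bullet> e j = (if i = j then 1 else 0)" and c: "\<And>i. 0 \<le> c i"
  shows "psd_sqrt (spectral_matrix e c) = spectral_matrix e (\<lambda>i. sqrt (c i))"
    and "inverse_sqrt (spectral_matrix e c) = spectral_matrix e (\<lambda>i. 1 / sqrt (c i))"
proof -
  let ?A = "spectral_matrix e c" and ?R = "spectral_matrix e (\<lambda>i. sqrt (c i))"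
    and ?S = "spectral_matrix e (\<lambda>i. 1 / sqrt (c i))"
  note [simp] = spectral_matrix_mult[OF e] psd_spectral_matrix[OF e]
  show R: "psd_sqrt ?A = ?R"
    by (rule psd_sqrt_eqI) (simp_all add: c)
  show "inverse_sqrt ?A = ?S"
  proof (cases "invertible ?A")
    case True
    have "c i \<noteq> 0" for i
    proof
      assume "c i = 0"
      then have "?A *v e i = 0"
        by (simp add: spectral_matrix_eigenvector[OF e])
      then have "e i = 0"
        using True by (metis invertible_def matrix_left_invertible_ker)
      then show False
        using e[of i i] by simp
    qed
    then have "?R ** ?S = mat 1"
      by (simp add: spectral_matrix_one[OF e])
    moreover from this have "?S ** ?R = mat 1"
      by (simp only: matrix_left_right_inverse)
    \<comment> \<open>\<open>matrix_inv\<close> is a choice operator, so evaluating it takes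
      uniqueness of the inverse.\<close>
    moreover have "X = ?S" if "?R ** X = mat 1" for X
    proof -
      have "X = (?S ** ?R) ** X"
        by (simp only: \<open>?S ** ?R = mat 1\<close> matrix_mul_lid)
      also have "\<dots> = ?S ** (?R ** X)"
        by (simp only: matrix_mul_assoc)
      finally show ?thesis
        by (simp only: that matrix_mul_rid)
    qed
    ultimately have "matrix_inv ?R = ?S"
      unfolding matrix_inv_def by (intro some_equality) auto
    then show ?thesis
      using True R by (simp add: inverse_sqrt_def)
  next
    case False
    \<comment> \<open>Two of the Penrose equations become pointwise identities that hold also where
      \<open>c i = 0\<close>; the other two are the symmetry of spectral matrices.\<close>
    have "moore_penrose ?A = spectral_matrix e (\<lambda>i. 1 / c i)"
      by (rule moore_penrose_eqI) (auto intro!: arg_cong[of _ _ "spectral_matrix e"])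
    moreover have "psd_sqrt (spectral_matrix e (\<lambda>i. 1 / c i)) = ?S"
      by (rule psd_sqrt_eqI) (simp_all add: c real_sqrt_divide flip: real_sqrt_mult)
    ultimately show ?thesis
      using False by (simp add: inverse_sqrt_def)
  qed
qed

text \<open>All that the later arguments use about the two roots: they are symmetric, commute and
  are generalized inverses of each other, so their product is the orthogonal projection onto their
  common range.\<close>

lemma inverse_sqrt_psd:
  fixes A :: "real^'m^'m"
  assumes "psd A"
  shows "transpose (psd_sqrt A) = psd_sqrt A"
    and "transpose (inverse_sqrt A) = inverse_sqrt A"
    and "psd_sqrt A ** psd_sqrt A = A"
    and "inverse_sqrt A ** psd_sqrt A = psd_sqrt A ** inverse_sqrt A"
    and "psd_sqrt A ** inverse_sqrt A ** psd_sqrt A = psd_sqrt A"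
    and "inverse_sqrt A ** psd_sqrt A ** inverse_sqrt A = inverse_sqrt A"
proof -
  obtain e :: "'m \<Rightarrow> real^'m" and c
    where e: "\<And>i j. e i \<bullet> e j = (if i = j then 1 else 0)" and c: "\<And>i. 0 \<le> c i"
      and A: "A = spectral_matrix e c"
    using psd_eigenbasis[OF assms] by metis
  note [simp] = A inverse_sqrt_spectral_matrix[OF e c] spectral_matrix_mult[OF e] c
  show "transpose (psd_sqrt A) = psd_sqrt A" "transpose (inverse_sqrt A) = inverse_sqrt A"
    "psd_sqrt A ** psd_sqrt A = A"
    "inverse_sqrt A ** psd_sqrt A = psd_sqrt A ** inverse_sqrt A"
    by (simp_all add: mult.commute)
  show "psd_sqrt A ** inverse_sqrt A ** psd_sqrt A = psd_sqrt A"
    "inverse_sqrt A ** psd_sqrt A ** inverse_sqrt A = inverse_sqrt A"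
    by (auto intro!: arg_cong[of _ _ "spectral_matrix e"])
qed

section \<open>The minimal trace problem\<close>

text \<open>Let \<open>E = A diag(g\<^sup>+)\<^sup>1\<^sup>/\<^sup>2\<close>, so that \<open>E E\<^sup>T \<ge> I\<close>, and let \<open>h p\<close> be the diagonal entries of the
  orthogonal projection onto the row space of \<open>E\<close> (its leverage scores). They sum to \<open>d\<close>, are at most
  1 and at most the squared norms of the columns of \<open>E\<close>, so the claim reduces to a linear program
  in \<open>h\<close> with weights \<open>1 / g p\<close>.\<close>

lemma trace_minimum:
  fixes A :: "'d::finite \<Rightarrow> 'm::finite \<Rightarrow> real" and g :: "'m \<Rightarrow> real"
  assumes T: "card T = CARD('d)" and pos: "\<And>p. p \<in> T \<Longrightarrow> 0 < g p"
    and gap: "\<And>p q. \<lbrakk>p \<in> T; q \<notin> T\<rbrakk> \<Longrightarrow> g q < g p"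
    and A: "\<And>j k. (\<Sum>p\<in>UNIV. A j p * g p * A k p) = (if j = k then 1 else 0)"
  shows "(\<Sum>p\<in>T. 1 / g p) \<le> (\<Sum>j\<in>UNIV. \<Sum>p\<in>UNIV. (A j p)\<^sup>2)"
    and "\<lbrakk>(\<Sum>j\<in>UNIV. \<Sum>p\<in>UNIV. (A j p)\<^sup>2) = (\<Sum>p\<in>T. 1 / g p); p \<notin> T\<rbrakk> \<Longrightarrow> A j p = 0"
proof -
  define E where "E j = (\<chi> p. if 0 < g p then A j p * sqrt (g p) else 0)" for j
  \<comment> \<open>The transpose of \<open>E\<close>: its range is the row space of
    \<open>E\<close>, and \<open>L_ge\<close> below says \<open>E E\<^sup>T \<ge> I\<close>.\<close>
  define L where "L c = (\<Sum>j\<in>UNIV. (c $ j) *\<^sub>R E j)" for c :: "real^'d"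
  have lin: "linear L"
    by (rule linearI) (simp_all add: L_def scaleR_left_distrib sum.distrib scaleR_sum_right)
  have L_ge: "c \<bullet> c \<le> L c \<bullet> L c" for c
  proof -
    define s where "s p = (\<Sum>j\<in>UNIV. c $ j * A j p)" for p
    have "c \<bullet> c = (\<Sum>j\<in>UNIV. \<Sum>k\<in>UNIV. c $ j * c $ k * (\<Sum>p\<in>UNIV. A j p * g p * A k p))"
      by (simp add: A inner_vec_def if_distrib[of "\<lambda>t. _ * t"] cong: if_cong)
    also have "\<dots> = (\<Sum>p\<in>UNIV. \<Sum>j\<in>UNIV. \<Sum>k\<in>UNIV. g p * ((c $ j * A j p) * (c $ k * A k p)))"
      by (subst sum.swap[of _ _ "UNIV :: 'm set"], rule sum.cong[OF refl], subst sum.swap)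
        (simp add: sum_distrib_left mult_ac)
    also have "\<dots> = (\<Sum>p\<in>UNIV. g p * (s p * s p))"
      unfolding s_def by (simp only: sum_product) (simp only: sum_distrib_left)
    \<comment> \<open>The terms with \<open>g p \<le> 0\<close> are not positive, so dropping them
      can only enlarge the sum.\<close>
    also have "\<dots> \<le> (\<Sum>p\<in>UNIV. L c $ p * L c $ p)"
    proof (rule sum_mono)
      fix p
      have "L c $ p = (if 0 < g p then sqrt (g p) * s p else 0)"
        by (simp add: L_def E_def s_def sum_distrib_left mult_ac)
      then show "g p * (s p * s p) \<le> L c $ p * L c $ p"
        by (cases "0 < g p")
          (simp_all add: power_mult_distrib mult_nonpos_nonneg flip: power2_eq_square)
    qed
    finally show ?thesis
      by (simp add: inner_vec_def)
  qed
  have "inj L"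
    using L_ge by (auto simp: linear_injective_0[OF lin])
       (metis inner_eq_zero_iff inner_ge_zero inner_zero_left order_antisym)
  then have dimL: "dim (range L) = CARD('d)"
    using dim_image_eq[OF lin, of UNIV] by simp
  obtain Q where Q: "Q \<subseteq> range L" "pairwise orthogonal Q" "\<And>q. q \<in> Q \<Longrightarrow> norm q = 1"
    "independent Q" "card Q = CARD('d)" "span Q = range L"
    using orthonormal_basis_subspace[OF linear_subspace_image[OF lin subspace_UNIV]] dimL by metis
  have finQ: "finite Q"
    using Q(4) by (rule independent_imp_finite)
  define h where "h p = (\<Sum>q\<in>Q. (q $ p)\<^sup>2)" for p
  define a where "a p = (\<Sum>j\<in>UNIV. (A j p)\<^sup>2)" for p
  have h0: "0 \<le> h p" for p
    by (simp add: h_def sum_nonneg)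
  have h_bounds: "h p \<le> 1 \<and> h p \<le> (\<Sum>j\<in>UNIV. (E j $ p)\<^sup>2)" for p
  proof (cases "h p = 0")
    case False
    then have h: "0 < h p"
      using h0[of p] by simp
    \<comment> \<open>The orthogonal projection of the \<open>p\<close>-th unit vector onto
      \<open>range L\<close>, whence \<open>v $ p = v \<bullet> v = h p\<close>.\<close>
    define v where "v = (\<Sum>q\<in>Q. (q $ p) *\<^sub>R q)"
    have vp: "v $ p = h p"
      by (simp add: v_def h_def power2_eq_square)
    have "v \<bullet> q = q $ p" if "q \<in> Q" for q
    proof -
      have "v \<bullet> q = (\<Sum>r\<in>Q. if r = q then q $ p else 0)"
        unfolding v_def inner_sum_left using Q(2,3) that
        by (intro sum.cong) (auto simp: pairwise_def orthogonal_def norm_eq_1)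
      then show ?thesis
        using that finQ by simp
    qed
    then have vv: "v \<bullet> v = h p"
      by (subst (2) v_def) (simp add: inner_sum_right h_def power2_eq_square)
    have "(h p)\<^sup>2 \<le> h p"
      using component_le_norm_cart[of v p] vp vv
      by (metis abs_le_square_iff abs_norm_cancel dot_square_norm)
    then have "h p \<le> 1"
      using h by (simp add: power2_eq_square)
    have "v \<in> range L"
      using Q(6) by (auto simp: v_def intro!: span_sum span_scale intro: span_base)
    then obtain c where c: "v = L c"
      by blast
    define y where "y = (\<chi> j. E j $ p)"
    \<comment> \<open>The second bound is Cauchy-Schwarz against column \<open>p\<close> of
      \<open>E\<close>, with \<open>c \<bullet> c \<le> v \<bullet> v = h p\<close> from
      \<open>L_ge\<close>.\<close>
    have "h p = c \<bullet> y"
      by (simp add: y_def c L_def inner_vec_def flip: vp)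
    then have "(h p)\<^sup>2 \<le> (c \<bullet> c) * (y \<bullet> y)"
      by (simp add: Cauchy_Schwarz_ineq)
    also have "\<dots> \<le> h p * (y \<bullet> y)"
      using L_ge[of c] vv c by (intro mult_right_mono) auto
    finally have "h p \<le> y \<bullet> y"
      using h by (simp add: power2_eq_square)
    then show ?thesis
      using \<open>h p \<le> 1\<close> by (simp add: y_def inner_vec_def power2_eq_square)
  qed (simp add: sum_nonneg)
  have h_zero: "h p = 0" if "g p \<le> 0" for p
    using that h_bounds[of p] h0[of p] by (simp add: E_def)
  have h_a: "h p / g p \<le> a p" if "0 < g p" for p
  proof -
    have "(\<Sum>j\<in>UNIV. (E j $ p)\<^sup>2) = a p * g p"
      using that by (simp add: E_def a_def power_mult_distrib sum_distrib_right)
    then show ?thesis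
      using h_bounds[of p] that by (simp add: field_simps)
  qed
  have "(\<Sum>p\<in>UNIV. h p) = (\<Sum>q\<in>Q. q \<bullet> q)"
    unfolding h_def by (subst sum.swap) (simp add: inner_vec_def power2_eq_square)
  also have "\<dots> = CARD('d)"
    using Q(3,5) by (simp add: norm_eq_1)
  finally have h_sum: "(\<Sum>p\<in>UNIV. h p) = CARD('d)" .
  have finT: "finite T" "T \<noteq> {}"
    using T by auto
  define m where "m = Min (g ` T)"
  have m: "0 < m" "\<And>p. p \<in> T \<Longrightarrow> m \<le> g p" "\<And>q. q \<notin> T \<Longrightarrow> g q < m"
    using finT pos gap by (auto simp: m_def)
  \<comment> \<open>A termwise lower bound for \<open>a\<close> whose total is the claimed minimum:
    \<open>m\<close> separates the values of \<open>g\<close> on \<open>T\<close> from those off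
    \<open>T\<close>, and the \<open>1 / m\<close> terms cancel because \<open>h\<close> sums to
    \<open>CARD('d) = card T\<close>.\<close>
  define t where "t p = h p / m + (if p \<in> T then 1 / g p - 1 / m else 0)" for p
  have t_a: "t p \<le> a p" for p
  proof (cases "p \<in> T")
    case True
    have "1 / g p \<le> 1 / m"
      using m True by (simp add: frac_le)
    \<comment> \<open>The factor \<open>1 / g p - 1 / m\<close> is not positive, so
      \<open>h p \<le> 1\<close> reverses the inequality.\<close>
    then have "(1 / g p - 1 / m) * 1 \<le> (1 / g p - 1 / m) * h p"
      using h_bounds[of p] by (intro mult_left_mono_neg) auto
    then show ?thesis
      using True h_a[of p] pos[of p] by (simp add: t_def algebra_simps)
  next
    case False
    show ?thesis
    proof (cases "0 < g p")
      case True
      then have "h p / m \<le> h p / g p"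
        using m(3)[OF False] h0[of p] by (intro divide_left_mono) auto
      then show ?thesis
        using False True h_a[of p] by (simp add: t_def)
    qed (use False h_zero[of p] in \<open>simp add: t_def a_def sum_nonneg\<close>)
  qed
  have "(\<Sum>p\<in>UNIV. t p) = (\<Sum>p\<in>UNIV. h p) / m + (\<Sum>p\<in>T. 1 / g p - 1 / m)"
    by (simp add: t_def sum.distrib sum_divide_distrib sum.If_cases)
  also have "\<dots> = (\<Sum>p\<in>T. 1 / g p)"
    using T by (simp add: h_sum sum_subtractf)
  finally have t_sum: "(\<Sum>p\<in>UNIV. t p) = (\<Sum>p\<in>T. 1 / g p)" .
  have a_sum: "(\<Sum>j\<in>UNIV. \<Sum>p\<in>UNIV. (A j p)\<^sup>2) = (\<Sum>p\<in>UNIV. a p)"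
    unfolding a_def by (rule sum.swap)
  show "(\<Sum>p\<in>T. 1 / g p) \<le> (\<Sum>j\<in>UNIV. \<Sum>p\<in>UNIV. (A j p)\<^sup>2)"
    unfolding a_sum t_sum[symmetric] by (rule sum_mono) (rule t_a)
  show "A j p = 0" if eq: "(\<Sum>j\<in>UNIV. \<Sum>p\<in>UNIV. (A j p)\<^sup>2) = (\<Sum>p\<in>T. 1 / g p)"
    and p: "p \<notin> T" for j p
  proof -
    have "a p = t p"
      using eq t_a sum_mono_inv[of t UNIV a p] by (simp add: a_sum t_sum)
    then have ap: "a p = h p / m"
      using p by (simp add: t_def)
    have "h p = 0"
    proof (cases "0 < g p")
      case True
      \<comment> \<open>Here \<open>h p / g p \<le> a p = h p / m\<close>, which together with
        \<open>g p < m\<close> leaves only \<open>h p = 0\<close>.\<close>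
      then have "h p * m \<le> h p * g p"
        using h_a[OF True] m(1) by (simp add: ap field_simps)
      then show ?thesis
        using m(3)[OF p] h0[of p] by (metis linorder_not_less mult_le_cancel_left nless_le)
    qed (simp add: h_zero)
    then have "a p = 0"
      by (simp add: ap)
    then show ?thesis
      by (simp add: a_def sum_nonneg_eq_0_iff)
  qed
qed

section \<open>Descending lists and their counting functions\<close>

lemma card_ge_descending:
  fixes s :: "nat \<Rightarrow> real"
  assumes s: "\<And>i j. \<lbrakk>i \<in> {1..M}; j \<in> {1..M}; i \<le> j\<rbrakk> \<Longrightarrow> s j \<le> s i" and j: "j \<in> {1..M}"
  shows "j \<le> card {i \<in> {1..M}. l \<le> s i} \<longleftrightarrow> l \<le> s j"
proof
  assume "l \<le> s j"
  \<comment> \<open>An upper level set of a descending list is an initial segment; both directions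
    compare it with the positions up to \<open>j\<close>.\<close>
  then have "{1..j} \<subseteq> {i \<in> {1..M}. l \<le> s i}"
    using s[OF _ j] j by fastforce
  then show "j \<le> card {i \<in> {1..M}. l \<le> s i}"
    using card_mono[of "{i \<in> {1..M}. l \<le> s i}" "{1..j}"] by simp
next
  assume le: "j \<le> card {i \<in> {1..M}. l \<le> s i}"
  show "l \<le> s j"
  proof (rule ccontr)
    assume "\<not> l \<le> s j"
    then have "i < j" if "i \<in> {1..M}" "l \<le> s i" for i
      using s[OF j that(1)] that by (metis not_less order_trans)
    then have "{i \<in> {1..M}. l \<le> s i} \<subseteq> {1..<j}"
      by auto
    from card_mono[OF _ this] have "card {i \<in> {1..M}. l \<le> s i} \<le> j - 1"
      by simp
    then show False
      using le j by (simp only: atLeastAtMost_iff) linarith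
  qed
qed

text \<open>Equal multiplicities at all levels from \<open>lam d\<close> upwards give equal numbers
  of entries \<open>\<ge> l\<close> for each such \<open>l\<close>, and by
  \<open>card_ge_descending\<close> these numbers determine the entries.\<close>

lemma descending_enumerations_agree:
  fixes \<gamma> lam :: "nat \<Rightarrow> real"
  assumes \<gamma>: "\<And>i j. \<lbrakk>i \<in> {1..N}; j \<in> {1..N}; i \<le> j\<rbrakk> \<Longrightarrow> \<gamma> j \<le> \<gamma> i"
    and lam: "\<And>i j. \<lbrakk>i \<in> {1..d}; j \<in> {1..d}; i \<le> j\<rbrakk> \<Longrightarrow> lam j \<le> lam i"
    and d: "1 \<le> d"
    and count: "\<And>l. lam d \<le> l \<Longrightarrow>
      card {j \<in> {1..N}. \<gamma> j = l} = card {j \<in> {1..d}. lam j = l}"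
  shows "d \<le> N" and "j \<in> {1..d} \<Longrightarrow> \<gamma> j = lam j" and "j \<in> {d<..N} \<Longrightarrow> \<gamma> j < lam d"
proof -
  have ge: "card {j \<in> {1..N}. l \<le> \<gamma> j} = card {j \<in> {1..d}. l \<le> lam j}" if l: "lam d \<le> l" for l
  proof -
    \<comment> \<open>The finitely many values \<open>\<ge> l\<close> that occur in either list;
      both counts are sorted by value.\<close>
    define X where "X = {y \<in> \<gamma> ` {1..N} \<union> lam ` {1..d}. l \<le> y}"
    have X: "finite X"
      by (simp add: X_def)
    have "card {j \<in> {1..M}. l \<le> s j} = (\<Sum>y\<in>X. card {j \<in> {1..M}. s j = y})"
      if "s ` {1..M} \<subseteq> \<gamma> ` {1..N} \<union> lam ` {1..d}" for s :: "nat \<Rightarrow> real" and M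
    proof -
      have "{j \<in> {1..M}. l \<le> s j} = (\<Union>y\<in>X. {j \<in> {1..M}. s j = y})"
        using subsetD[OF that imageI] by (auto simp: X_def)
      then show ?thesis
        using X by (simp only:) (intro card_UN_disjoint, auto)
    qed
    note this[of \<gamma> N] this[of lam d]
    moreover have "(\<Sum>y\<in>X. card {j \<in> {1..N}. \<gamma> j = y}) = (\<Sum>y\<in>X. card {j \<in> {1..d}. lam j = y})"
      by (rule sum.cong[OF refl], rule count) (use l in \<open>auto simp: X_def\<close>)
    ultimately show ?thesis
      by simp
  qed
  have "{j \<in> {1..d}. lam d \<le> lam j} = {1..d}"
    using lam d by auto
  then have ged: "card {j \<in> {1..N}. lam d \<le> \<gamma> j} = d"
    using ge[of "lam d"] by simp
  moreover have "card {j \<in> {1..N}. lam d \<le> \<gamma> j} \<le> N"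
    using card_mono[of "{1..N}" "{j \<in> {1..N}. lam d \<le> \<gamma> j}"] by force
  ultimately show dN: "d \<le> N"
    by simp
  note iff = card_ge_descending[where s = \<gamma> and M = N, OF \<gamma>]
    card_ge_descending[where s = lam and M = d, OF lam]
  show "\<gamma> j = lam j" if j: "j \<in> {1..d}"
  proof -
    have jN: "j \<in> {1..N}"
      using j dN by auto
    have ld: "lam d \<le> lam j"
      using lam j d by auto
    then have "lam j \<le> \<gamma> j"
      using iff(1)[OF _ _ _ jN, of "lam j"] iff(2)[OF _ _ _ j, of "lam j"] ge[OF ld] by simp
    moreover from this have "\<gamma> j \<le> lam j"
      using iff(1)[OF _ _ _ jN, of "\<gamma> j"] iff(2)[OF _ _ _ j, of "\<gamma> j"] ge[of "\<gamma> j"] ld by simp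
    ultimately show ?thesis
      by simp
  qed
  \<comment> \<open>Exactly \<open>d\<close> entries of \<open>\<gamma>\<close> reach the level
    \<open>lam d\<close>, so later positions lie strictly below it.\<close>
  show "\<gamma> j < lam d" if j: "j \<in> {d<..N}"
    using iff(1)[of j "lam d"] ged j by fastforce
qed

section \<open>The kernel sample and its eigenspaces\<close>

lemma sum_UNIV_sum: "(\<Sum>p\<in>UNIV. f p) = (\<Sum>i\<in>UNIV. f (Inl i)) + (\<Sum>i\<in>UNIV. f (Inr i))"
  for f :: "'a::finite + 'b::finite \<Rightarrow> 'c::comm_monoid_add"
  by (subst UNIV_Plus_UNIV[symmetric], subst sum.Plus) simp_all

text \<open>The \<open>J\<close> of the overview: \<open>case_sum Inr Inl\<close> exchanges the two
  blocks.\<close>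

definition swap_matrix :: "real^('n::finite + 'n)^('n + 'n)" where
  "swap_matrix = (\<chi> p q. if q = case_sum Inr Inl p then 1 / (2 * real CARD('n)) else 0)"

lemma swap_matrix_mult:
  "(swap_matrix *v c) $ p = c $ (case_sum Inr Inl p :: 'n::finite + 'n) / (2 * real CARD('n))"
  by (simp add: swap_matrix_def matrix_vector_mult_def if_distrib[of "\<lambda>t. t * _"] cong: if_cong)

lemma transpose_swap_matrix: "transpose swap_matrix = swap_matrix"
  by (auto simp: swap_matrix_def transpose_def vec_eq_iff split: sum.splits)

locale kernel_sample =
  fixes \<phi> :: "'x \<Rightarrow> 'h::real_inner"
    and K :: "'x \<Rightarrow> 'x \<Rightarrow> real"
    and x x' :: "'n::finite \<Rightarrow> 'x"
  assumes K: "\<And>y z. K y z = \<phi> y \<bullet> \<phi> z"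
begin

abbreviation point :: "'n + 'n \<Rightarrow> 'x" where
  "point \<equiv> case_sum x x'"

abbreviation Gram :: "real^('n + 'n)^('n + 'n)" where
  "Gram \<equiv> K_tilde K x x'"

abbreviation R :: "real^('n + 'n)^('n + 'n)" where
  "R \<equiv> psd_sqrt Gram"

abbreviation S :: "real^('n + 'n)^('n + 'n)" where
  "S \<equiv> inverse_sqrt Gram"

abbreviation \<Gamma> :: "'h \<Rightarrow> 'h" where
  "\<Gamma> \<equiv> feature_cross_corr \<phi> x x'"

definition synthesis :: "real^('n + 'n) \<Rightarrow> 'h" where
  "synthesis c = (\<Sum>p\<in>UNIV. c $ p *\<^sub>R \<phi> (point p))"

text \<open>The adjoint \<open>\<Phi>\<^sup>T\<close> of \<open>synthesis\<close>, as
  \<open>inner_synthesis\<close> confirms.\<close>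

definition analysis :: "'h \<Rightarrow> real^('n + 'n)" where
  "analysis w = (\<chi> p. \<phi> (point p) \<bullet> w)"

text \<open>The partial isometry \<open>V = \<Phi> S\<close> of the overview.\<close>

definition lift :: "real^('n + 'n) \<Rightarrow> 'h" where
  "lift u = synthesis (S *v u)"

lemma K_commute: "K y z = K z y"
  by (simp add: K inner_commute)

lemma linear_synthesis: "linear synthesis"
  by (rule linearI) (simp_all add: synthesis_def scaleR_left_distrib sum.distrib scaleR_sum_right)

lemma linear_analysis: "linear analysis"
  by (rule linearI) (simp_all add: analysis_def vec_eq_iff inner_add_right)

lemma linear_lift: "linear lift"
  unfolding lift_def
  by (rule linear_compose[of "(*v) S" synthesis, unfolded o_def])
    (simp_all add: linear_synthesis)

lemma inner_synthesis: "synthesis c \<bullet> w = c \<bullet> analysis w"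
  by (simp add: synthesis_def analysis_def inner_sum_left inner_vec_def)

lemma Gram_nth: "Gram $ p $ q = K (point p) (point q)"
  by (cases p; cases q) (simp_all add: K_tilde_def block_matrix_def kernel_matrix_def)

lemma transpose_Gram: "transpose Gram = Gram"
  by (simp add: vec_eq_iff transpose_def Gram_nth K_commute)

lemma kernel_vector_eq: "kernel_vector K x x' a = analysis (\<phi> a)"
  unfolding kernel_vector_def analysis_def vec_eq_iff by (auto simp: K split: sum.split)

lemma analysis_synthesis: "analysis (synthesis c) = Gram *v c"
  by (simp add: vec_eq_iff analysis_def synthesis_def matrix_vector_mult_def Gram_nth K
      inner_sum_right mult.commute)

lemma psd_Gram: "psd Gram"
proof -
  have "0 \<le> v \<bullet> (Gram *v v)" for v
    by (metis analysis_synthesis inner_ge_zero inner_synthesis)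
  then show ?thesis
    by (simp add: psd_def transpose_Gram)
qed

lemma transpose_R: "transpose R = R"
  and transpose_S: "transpose S = S"
  by (simp_all add: inverse_sqrt_psd[OF psd_Gram])

lemma R_R: "R *v (R *v c) = Gram *v c"
  by (simp add: matrix_vector_mul_assoc inverse_sqrt_psd(3)[OF psd_Gram])

lemma S_R: "S *v (R *v c) = R *v (S *v c)"
  by (simp add: matrix_vector_mul_assoc inverse_sqrt_psd(4)[OF psd_Gram])

lemma R_S_R: "R *v (S *v (R *v c)) = R *v c"
  by (simp add: matrix_vector_mul_assoc matrix_mul_assoc inverse_sqrt_psd(5)[OF psd_Gram])

lemma S_R_S: "S *v (R *v (S *v c)) = S *v c"
  by (simp add: matrix_vector_mul_assoc matrix_mul_assoc inverse_sqrt_psd(6)[OF psd_Gram])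

lemma inner_R: "(R *v c) \<bullet> d = c \<bullet> (R *v d)"
  and inner_S: "(S *v c) \<bullet> d = c \<bullet> (S *v d)"
  by (simp_all add: inner_matrix_vector_left transpose_R transpose_S)

lemma S_Gram: "S *v (Gram *v c) = R *v c"
  by (metis R_R R_S_R S_R)

lemma Gram_S: "Gram *v (S *v c) = R *v c"
  by (metis R_R R_S_R S_R)

text \<open>\<open>R S c - c\<close> lies in the kernel of the Gram matrix, which is the kernel of
  \<open>synthesis\<close> because \<open>synthesis d\<close> has squared norm
  \<open>d \<bullet> Gram d\<close>.\<close>

lemma synthesis_R_S: "synthesis (R *v (S *v c)) = synthesis c"
proof -
  let ?d = "R *v (S *v c) - c"
  have "Gram *v (R *v (S *v c)) = Gram *v c"
    by (metis R_R R_S_R S_R)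
  then have "Gram *v ?d = 0"
    by (simp add: matrix_vector_mult_diff_distrib)
  then have "synthesis ?d \<bullet> synthesis ?d = 0"
    by (simp add: inner_synthesis analysis_synthesis)
  then show ?thesis
    by (simp add: linear_diff[OF linear_synthesis])
qed

text \<open>The adjoint of \<open>synthesis_R_S\<close>.\<close>

lemma R_S_analysis: "R *v (S *v analysis w) = analysis w"
proof -
  have "d \<bullet> (R *v (S *v analysis w)) = d \<bullet> analysis w" for d
    using synthesis_R_S[of d] by (metis S_R inner_R inner_S inner_synthesis)
  then show ?thesis
    by (metis vector_eq_ldot)
qed

lemma \<Gamma>_eq: "\<Gamma> w = synthesis (swap_matrix *v analysis w)"
  by (simp add: feature_cross_corr_def outer_op_def synthesis_def swap_matrix_mult analysis_def
      sum_UNIV_sum sum.distrib scaleR_sum_right scaleR_add_right add.commute)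

lemma Z_eq: "Z_mat K x x' = Gram ** swap_matrix ** Gram"
proof -
  have M: "M_mat K x x' $ p $ q =
      (\<Sum>i\<in>UNIV. K (point p) (x' i) * K (x i) (point q)) / (2 * real CARD('n))" for p q
    by (cases p; cases q)
      (simp_all add: M_mat_def block_matrix_def kernel_matrix_def matrix_matrix_mult_def)
  \<comment> \<open>Reading the product column by column makes \<open>swap_matrix_mult\<close>, a
    statement about vectors, applicable.\<close>
  have "(Gram ** swap_matrix ** Gram) $ p $ q =
      ((Gram ** swap_matrix) *v column q Gram) $ p" for p q
    by (simp add: column_def matrix_matrix_mult_def matrix_vector_mult_def)
  also have "\<dots> p q = Z_mat K x x' $ p $ q" for p q
    by (simp add: matrix_vector_mult_def[of Gram] swap_matrix_mult column_def
        flip: matrix_vector_mul_assoc)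
      (simp add: Gram_nth
        sum_UNIV_sum Z_mat_def M transpose_def sum_divide_distrib K_commute[of "point q"]
        K_commute[of _ "point p"] mult.commute)
  finally show ?thesis
    by (simp add: vec_eq_iff)
qed

lemma K_Gamma_eq: "K_Gamma K x x' *v u = R *v (swap_matrix *v (R *v u))"
  by (simp add: K_Gamma_def Z_eq S_Gram Gram_S flip: matrix_vector_mul_assoc)

lemma inner_lift: "lift u \<bullet> w = u \<bullet> (S *v analysis w)"
  by (simp add: lift_def inner_synthesis inner_S)

lemma S_analysis_lift: "S *v analysis (lift u) = R *v (S *v u)"
  by (simp add: lift_def analysis_synthesis S_Gram)

text \<open>The intertwining relation for \<open>V = lift\<close>; the next lemma is its adjoint
  form.\<close>

lemma \<Gamma>_lift: "\<Gamma> (lift u) = lift (K_Gamma K x x' *v u)"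
  by (simp add: \<Gamma>_eq lift_def analysis_synthesis Gram_S K_Gamma_eq S_R synthesis_R_S)

lemma K_Gamma_S_analysis: "K_Gamma K x x' *v (S *v analysis w) = S *v analysis (\<Gamma> w)"
  by (simp add: \<Gamma>_eq K_Gamma_eq analysis_synthesis S_Gram R_S_analysis)

text \<open>An eigenvector for a nonzero eigenvalue lies in the range of \<open>R\<close>, on which
  the projection \<open>R S\<close> is the identity.\<close>

lemma R_S_eigenvector:
  assumes "K_Gamma K x x' *v u = l *\<^sub>R u" "l \<noteq> 0"
  shows "R *v (S *v u) = u"
proof -
  have "u = R *v ((1 / l) *\<^sub>R (swap_matrix *v (R *v u)))"
    using assms by (simp add: matrix_vector_mult_scaleR flip: K_Gamma_eq)
  then show ?thesis
    by (metis R_S_R)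
qed

text \<open>Dividing by \<open>l\<close> puts \<open>w\<close> into the range of
  \<open>synthesis\<close>, on which \<open>V V\<^sup>T\<close> is the identity.\<close>

lemma lift_eigenvector:
  assumes "\<Gamma> w = l *\<^sub>R w" "l \<noteq> 0"
  shows "lift (S *v analysis w) = w"
proof -
  define c where "c = (1 / l) *\<^sub>R (swap_matrix *v analysis w)"
  have "w = synthesis c"
    using assms by (simp add: c_def linear_scale[OF linear_synthesis] flip: \<Gamma>_eq)
  then show ?thesis
    by (simp add: lift_def analysis_synthesis S_Gram S_R synthesis_R_S)
qed

lemma eigenvalue_K_Gamma_iff:
  assumes "l \<noteq> 0"
  shows "eigenvalue ((*v) (K_Gamma K x x')) l \<longleftrightarrow> eigenvalue \<Gamma> l"
proof
  assume "eigenvalue ((*v) (K_Gamma K x x')) l"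
  then obtain u where u: "u \<noteq> 0" "K_Gamma K x x' *v u = l *\<^sub>R u"
    by (auto simp: eigenvalue_def)
  have "\<Gamma> (lift u) = l *\<^sub>R lift u"
    by (simp add: \<Gamma>_lift u linear_scale[OF linear_lift])
  moreover have "lift u \<noteq> 0"
    using S_analysis_lift[of u] R_S_eigenvector[OF u(2) assms] u(1)
    by (auto simp: linear_0[OF linear_analysis])
  ultimately show "eigenvalue \<Gamma> l"
    by (auto simp: eigenvalue_def)
next
  assume "eigenvalue \<Gamma> l"
  then obtain w where w: "w \<noteq> 0" "\<Gamma> w = l *\<^sub>R w"
    by (auto simp: eigenvalue_def)
  let ?u = "S *v analysis w"
  have "K_Gamma K x x' *v ?u = l *\<^sub>R ?u"
    by (simp add: K_Gamma_S_analysis w linear_scale[OF linear_analysis] matrix_vector_mult_scaleR)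
  moreover have "?u \<noteq> 0"
    using lift_eigenvector[OF w(2) assms] w(1) by (auto simp: linear_0[OF linear_lift])
  ultimately show "eigenvalue ((*v) (K_Gamma K x x')) l"
    by (auto simp: eigenvalue_def)
qed

end

section \<open>Eigenspaces of \<open>\<Gamma>\<close> from an eigenbasis of
  \<open>K_Gamma\<close>\<close>

locale kernel_sample_eigenbasis = kernel_sample \<phi> K x x'
  for \<phi> :: "'x \<Rightarrow> 'h::real_inner" and K and x x' :: "'n::finite \<Rightarrow> 'x" +
  fixes b :: "nat \<Rightarrow> real^('n + 'n)" and \<gamma> :: "nat \<Rightarrow> real"
  assumes b_orthonormal: "orthonormal_family (2 * CARD('n)) b"
    and b_eigen: "\<And>j. j \<in> {1..2 * CARD('n)} \<Longrightarrow> K_Gamma K x x' *v b j = \<gamma> j *\<^sub>R b j"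
begin

lemma inner_b:
  "\<lbrakk>i \<in> {1..2 * CARD('n)}; j \<in> {1..2 * CARD('n)}\<rbrakk> \<Longrightarrow> b i \<bullet> b j = (if i = j then 1 else 0)"
  using b_orthonormal by (auto simp: orthonormal_family_def)

lemma b_expansion: "u = (\<Sum>j\<in>{1..2 * CARD('n)}. (u \<bullet> b j) *\<^sub>R b j)"
  by (rule orthonormal_expansion) (auto simp: inner_b)

lemma transpose_K_Gamma: "transpose (K_Gamma K x x') = K_Gamma K x x'"
proof -
  have "transpose (R ** swap_matrix ** R) = R ** swap_matrix ** R"
    by (simp add: matrix_transpose_mul transpose_R transpose_swap_matrix matrix_mul_assoc)
  moreover have "K_Gamma K x x' = R ** swap_matrix ** R"
    by (simp add: matrix_eq K_Gamma_eq flip: matrix_vector_mul_assoc)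
  ultimately show ?thesis
    by simp
qed

text \<open>\<open>V\<^sup>T V = R S\<close> fixes \<open>b j\<close>; a nonzero eigenvalue is
  required for only one of the two vectors.\<close>

lemma inner_lift_b:
  assumes "i \<in> {1..2 * CARD('n)}" "j \<in> {1..2 * CARD('n)}" "\<gamma> j \<noteq> 0"
  shows "lift (b i) \<bullet> lift (b j) = (if i = j then 1 else 0)"
  using assms R_S_eigenvector[OF b_eigen] by (simp add: inner_lift S_analysis_lift inner_b)

lemma \<Gamma>_lift_b:
  "j \<in> {1..2 * CARD('n)} \<Longrightarrow> \<Gamma> (lift (b j)) = \<gamma> j *\<^sub>R lift (b j)"
  by (simp add: \<Gamma>_lift b_eigen linear_scale[OF linear_lift])

text \<open>Transport \<open>w\<close> to the eigenvector \<open>u\<close> of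
  \<open>K_Gamma\<close>, expand it in \<open>b\<close>, where only terms with eigenvalue
  \<open>l\<close> survive by symmetry, and lift back.\<close>

lemma \<Gamma>_eigenvector_expansion:
  assumes w: "\<Gamma> w = l *\<^sub>R w" and l: "l \<noteq> 0"
  shows "w = (\<Sum>j | j \<in> {1..2 * CARD('n)} \<and> \<gamma> j = l. (w \<bullet> lift (b j)) *\<^sub>R lift (b j))"
proof -
  define u where "u = S *v analysis w"
  have u: "K_Gamma K x x' *v u = l *\<^sub>R u"
    by (simp add: u_def K_Gamma_S_analysis w linear_scale[OF linear_analysis]
        matrix_vector_mult_scaleR)
  have ub: "u \<bullet> b j = w \<bullet> lift (b j)" for j
    by (metis inner_commute inner_lift u_def)
  have zero: "u \<bullet> b j = 0" if j: "j \<in> {1..2 * CARD('n)}" and "\<gamma> j \<noteq> l" for j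
  proof -
    have "l * (u \<bullet> b j) = (K_Gamma K x x' *v u) \<bullet> b j"
      by (simp add: u)
    also have "\<dots> = \<gamma> j * (u \<bullet> b j)"
      by (simp add: inner_matrix_vector_left transpose_K_Gamma b_eigen[OF j])
    finally show ?thesis
      using \<open>\<gamma> j \<noteq> l\<close> by simp
  qed
  have "w = lift u"
    by (simp add: u_def lift_eigenvector[OF w l])
  also have "\<dots> = (\<Sum>j\<in>{1..2 * CARD('n)}. (u \<bullet> b j) *\<^sub>R lift (b j))"
    by (subst b_expansion[of u])
      (simp add: linear_sum[OF linear_lift] linear_scale[OF linear_lift])
  also have "\<dots> = (\<Sum>j | j \<in> {1..2 * CARD('n)} \<and> \<gamma> j = l. (u \<bullet> b j) *\<^sub>R lift (b j))"
    by (rule sum.mono_neutral_right) (auto simp: zero)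
  finally show ?thesis
    by (simp add: ub)
qed

text \<open>The lifted \<open>b j\<close> with \<open>\<gamma> j = l\<close> form an orthonormal
  basis of the eigenspace.\<close>

lemma multiplicity_\<Gamma>:
  assumes l: "l \<noteq> 0"
  shows "multiplicity_of \<Gamma> l = enat (card {j \<in> {1..2 * CARD('n)}. \<gamma> j = l})"
proof -
  let ?J = "{j \<in> {1..2 * CARD('n)}. \<gamma> j = l}"
  let ?B = "(\<lambda>j. lift (b j)) ` ?J"
  have ortho: "lift (b i) \<bullet> lift (b j) = (if i = j then 1 else 0)" if "i \<in> ?J" "j \<in> ?J" for i j
    using that l by (intro inner_lift_b) auto
  have inj: "inj_on (\<lambda>j. lift (b j)) ?J"
  proof (rule inj_onI)
    fix i j assume "i \<in> ?J" "j \<in> ?J" and "lift (b i) = lift (b j)"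
    then show "i = j"
      using ortho[of i j] ortho[of j j] by (simp split: if_splits)
  qed
  have "subspace (eigenspace \<Gamma> l)"
  proof (rule subspaceI)
    show "0 \<in> eigenspace \<Gamma> l"
      by (simp add: eigenspace_def \<Gamma>_eq linear_0[OF linear_analysis] linear_0[OF linear_synthesis])
  next
    fix v w assume "v \<in> eigenspace \<Gamma> l" "w \<in> eigenspace \<Gamma> l"
    then show "v + w \<in> eigenspace \<Gamma> l"
      by (simp add: eigenspace_def \<Gamma>_eq linear_add[OF linear_analysis]
          linear_add[OF linear_synthesis] matrix_vector_right_distrib scaleR_add_right)
  next
    fix c v assume "v \<in> eigenspace \<Gamma> l"
    then show "c *\<^sub>R v \<in> eigenspace \<Gamma> l"
      by (simp add: eigenspace_def \<Gamma>_eq linear_scale[OF linear_analysis]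
          linear_scale[OF linear_synthesis] matrix_vector_mult_scaleR)
  qed
  moreover have "?B \<subseteq> eigenspace \<Gamma> l"
    by (auto simp: eigenspace_def \<Gamma>_lift_b)
  moreover have "eigenspace \<Gamma> l \<subseteq> span ?B"
  proof
    fix w assume "w \<in> eigenspace \<Gamma> l"
    then have "\<Gamma> w = l *\<^sub>R w"
      by (simp add: eigenspace_def)
    \<comment> \<open>\<open>w\<close> occurs on both sides of its expansion, so it is substituted
      once, in an explicit context.\<close>
    show "w \<in> span ?B"
      by (rule ssubst[where P = "\<lambda>v. v \<in> span ?B",
            OF \<Gamma>_eigenvector_expansion[OF \<open>\<Gamma> w = l *\<^sub>R w\<close> l]])
        (auto intro!: span_sum span_scale intro: span_base)
  qed
  ultimately have span: "span ?B = eigenspace \<Gamma> l"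
    by (simp add: span_minimal subset_antisym)
  have "independent ?B"
  proof (rule pairwise_orthogonal_independent)
    show "pairwise orthogonal ?B"
      by (auto simp: pairwise_def orthogonal_def ortho)
    show "0 \<notin> ?B"
    proof
      assume "0 \<in> ?B"
      then obtain j where "j \<in> ?J" "lift (b j) = 0"
        by (metis (no_types, lifting) imageE)
      then show False
        using ortho[of j j] by simp
    qed
  qed
  moreover have "span ?B = span (eigenspace \<Gamma> l)"
    by (simp only: span[symmetric] span_span)
  ultimately have "dim (eigenspace \<Gamma> l) = card ?B"
    by (intro dim_eq_card)
  then have "dim (eigenspace \<Gamma> l) = card ?J"
    by (simp only: card_image[OF inj])
  moreover have "\<exists>B. finite B \<and> eigenspace \<Gamma> l \<subseteq> span B"
    using \<open>eigenspace \<Gamma> l \<subseteq> span ?B\<close> by (intro exI[of _ ?B]) simp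
  ultimately show ?thesis
    by (simp only: multiplicity_of_def if_True)
qed

end

section \<open>Top spectral embeddings\<close>

lemma diag_mult: "diag v *v y = (\<chi> i. v i * y $ i)"
  by (simp add: diag_def matrix_vector_mult_def if_distrib[of "\<lambda>t. t * _"] cong: if_cong)

lemma orthogonal_matrixI:
  fixes U :: "real^'d^'d"
  assumes "\<And>j k. (\<Sum>i\<in>UNIV. U $ j $ i * U $ k $ i) = (if j = k then 1 else 0)"
  shows "orthogonal_matrix U"
proof -
  have "U ** transpose U = mat 1"
    by (simp add: vec_eq_iff matrix_matrix_mult_def transpose_def mat_def assms)
  then show ?thesis
    by (simp add: orthogonal_matrix_def matrix_left_right_inverse)
qed

lemma orthogonal_matrix_rows:
  fixes U :: "real^'d^'d"
  assumes "orthogonal_matrix U"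
  shows "(\<Sum>i\<in>UNIV. U $ j $ i * U $ k $ i) = (if j = k then 1 else 0)"
proof -
  have "(U ** transpose U) $ j $ k = (mat 1 :: real^'d^'d) $ j $ k"
    using assms by (simp add: orthogonal_matrix_def)
  then show ?thesis
    by (simp add: matrix_matrix_mult_def transpose_def mat_def)
qed

lemma orthogonal_matrix_columns:
  fixes U :: "real^'d^'d"
  assumes "orthogonal_matrix U"
  shows "(\<Sum>i\<in>UNIV. U $ i $ j * U $ i $ k) = (if j = k then 1 else 0)"
proof -
  have "orthogonal_matrix (transpose U)"
    using assms by (simp add: orthogonal_matrix_transpose)
  from orthogonal_matrix_rows[OF this, of j k] show ?thesis
    by (simp add: transpose_def)
qed

lemma powr_minus_half: "0 < (t::real) \<Longrightarrow> t powr (-1/2) = 1 / sqrt t"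
  by (simp add: powr_minus_divide powr_half_sqrt)

section \<open>The top eigenvalues and the orthogonal freedom in the eigenvectors\<close>

locale kernel_sample_top = kernel_sample_eigenbasis \<phi> K x x' b \<gamma>
  for \<phi> :: "'x \<Rightarrow> 'h::real_inner" and K and x x' :: "'n::finite \<Rightarrow> 'x"
    and b :: "nat \<Rightarrow> real^('n + 'n)" and \<gamma> :: "nat \<Rightarrow> real" +
  fixes idx :: "'d::finite \<Rightarrow> nat" and lam :: "nat \<Rightarrow> real"
  assumes \<gamma>_descending:
      "\<And>i j. \<lbrakk>i \<in> {1..2 * CARD('n)}; j \<in> {1..2 * CARD('n)}; i \<le> j\<rbrakk> \<Longrightarrow> \<gamma> j \<le> \<gamma> i"
    and idx: "bij_betw idx UNIV {1..CARD('d)}"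
    and largest: "largest_eigenvalues \<Gamma> CARD('d) lam"
    and positive: "\<And>j. j \<in> {1..CARD('d)} \<Longrightarrow> 0 < lam j"
    and gap: "\<And>mu. largest_eigenvalues \<Gamma> (CARD('d) + 1) mu \<Longrightarrow> mu (CARD('d) + 1) < mu CARD('d)"
begin

lemma card_d: "CARD('d) \<in> {1..CARD('d)}"
  by (simp add: Suc_le_eq)

lemma lam_descending:
  "\<lbrakk>i \<in> {1..CARD('d)}; j \<in> {1..CARD('d)}; i \<le> j\<rbrakk> \<Longrightarrow> lam j \<le> lam i"
  using largest unfolding largest_eigenvalues_def by blast

text \<open>Strictly above the last listed value the list itself fixes the multiplicity. At that
  value the gap enters: were a copy missing, appending it would give a list of \<open>d + 1\<close>
  largest eigenvalues whose last two entries coincide.\<close>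

lemma card_eigenvalue:
  assumes l: "lam CARD('d) \<le> l"
  shows "card {j \<in> {1..2 * CARD('n)}. \<gamma> j = l} = card {j \<in> {1..CARD('d)}. lam j = l}"
proof -
  let ?c = "\<lambda>l. card {j \<in> {1..CARD('d)}. lam j = l}"
  have mult: "multiplicity_of \<Gamma> l = enat (card {j \<in> {1..2 * CARD('n)}. \<gamma> j = l})"
    using positive[OF card_d] l by (intro multiplicity_\<Gamma>) simp
  have le: "enat (?c m) \<le> multiplicity_of \<Gamma> m" for m
    using largest unfolding largest_eigenvalues_def by blast
  have above: "multiplicity_of \<Gamma> m \<le> enat (?c m)"
    if "j \<in> {1..CARD('d)}" "lam j < m" for j m
    using largest that unfolding largest_eigenvalues_def by blast
  have "multiplicity_of \<Gamma> l \<le> enat (?c l)"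
  proof (cases "lam CARD('d) < l")
    case True
    then show ?thesis
      using above card_d by blast
  next
    case False
    then have ld: "l = lam CARD('d)"
      using l by simp
    show ?thesis
    proof (rule ccontr)
      assume "\<not> ?thesis"
      then have less: "enat (?c l + 1) \<le> multiplicity_of \<Gamma> l"
        by (simp add: mult)
      define mu where "mu = lam(CARD('d) + 1 := l)"
      have mu_lam: "mu j = lam j" if "j \<in> {1..CARD('d)}" for j
        using that by (simp add: mu_def)
      have mu_last: "mu (CARD('d) + 1) = l"
        by (simp add: mu_def)
      have split: "{1..CARD('d) + 1} = insert (CARD('d) + 1) {1..CARD('d)}"
        by auto
      have count_l: "card {j \<in> {1..CARD('d) + 1}. mu j = l} = ?c l + 1"
      proof -
        have "{j \<in> {1..CARD('d) + 1}. mu j = l}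
            = insert (CARD('d) + 1) {j \<in> {1..CARD('d)}. lam j = l}"
          unfolding split using mu_lam mu_last by auto
        then show ?thesis
          by simp
      qed
      have count_other: "card {j \<in> {1..CARD('d) + 1}. mu j = m} = ?c m" if "m \<noteq> l" for m
      proof -
        have "{j \<in> {1..CARD('d) + 1}. mu j = m} = {j \<in> {1..CARD('d)}. lam j = m}"
          unfolding split using mu_lam mu_last that by auto
        then show ?thesis
          by simp
      qed
      have "largest_eigenvalues \<Gamma> (CARD('d) + 1) mu"
        unfolding largest_eigenvalues_def
      proof (intro conjI ballI allI impI)
        fix i j assume "i \<in> {1..CARD('d) + 1}" "j \<in> {1..CARD('d) + 1}" "i \<le> j"
        then show "mu j \<le> mu i"
          using lam_descending[of i j] lam_descending[OF _ card_d, of i]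
          by (auto simp: mu_def ld)
      next
        fix m
        show "enat (card {j \<in> {1..CARD('d) + 1}. mu j = m}) \<le> multiplicity_of \<Gamma> m"
          by (cases "m = l") (simp_all only: count_l count_other less le simp_thms)
      next
        fix m assume "\<exists>j\<in>{1..CARD('d) + 1}. mu j < m"
        then obtain i where i: "i \<in> {1..CARD('d) + 1}" "mu i < m"
          by blast
        obtain j where j: "j \<in> {1..CARD('d)}" "lam j < m"
        proof (cases "i = CARD('d) + 1")
          case True
          then show ?thesis
            using that[OF card_d] i mu_last ld by simp
        next
          case False
          then have "i \<in> {1..CARD('d)}"
            using i by auto
          then show ?thesis
            using that i mu_lam by simp
        qed
        \<comment> \<open>A value above some entry of \<open>mu\<close> is strictly above
          \<open>l\<close>, so the appended copy does not change its count.\<close>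
        have "l \<le> lam j"
          using lam_descending[OF j(1) card_d] j ld by auto
        then have "m \<noteq> l"
          using j by simp
        then show "multiplicity_of \<Gamma> m \<le> enat (card {j \<in> {1..CARD('d) + 1}. mu j = m})"
          using above[OF j] count_other[OF \<open>m \<noteq> l\<close>] by argo
      qed
      from gap[OF this] show False
        by (simp add: mu_def ld)
    qed
  qed
  with le[of l] show ?thesis
    by (simp add: mult)
qed

lemma d_le: "CARD('d) \<le> 2 * CARD('n)"
  and \<gamma>_eq_lam: "j \<in> {1..CARD('d)} \<Longrightarrow> \<gamma> j = lam j"
  and \<gamma>_less: "j \<in> {CARD('d)<..2 * CARD('n)} \<Longrightarrow> \<gamma> j < lam CARD('d)"
  using descending_enumerations_agree[where \<gamma> = \<gamma> and lam = lam, OF \<gamma>_descending lam_descending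
      _ card_eigenvalue] card_d by auto

lemma idx_mem: "idx i \<in> {1..CARD('d)}" "idx i \<in> {1..2 * CARD('n)}"
proof -
  show "idx i \<in> {1..CARD('d)}"
    using bij_betwE[OF idx] by blast
  then show "idx i \<in> {1..2 * CARD('n)}"
    using d_le by auto
qed

lemma idx_eq_iff: "idx i = idx j \<longleftrightarrow> i = j"
  using idx by (auto simp: bij_betw_def inj_on_def)

lemma \<gamma>_pos: "0 < \<gamma> (idx i)"
  using positive[OF idx_mem(1)] \<gamma>_eq_lam[OF idx_mem(1)] by simp

lemma inner_lift_b_idx: "lift (b (idx i)) \<bullet> lift (b (idx j)) = (if i = j then 1 else 0)"
  using inner_lift_b[OF idx_mem(2) idx_mem(2)] \<gamma>_pos[of j] by (simp add: idx_eq_iff)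

text \<open>The top spectral map with the lifted \<open>b j\<close> as eigenvectors and
  \<open>U\<close> the identity; it serves as the reference for all others.\<close>

abbreviation whitening :: "'h \<Rightarrow> real^'d" where
  "whitening w \<equiv> (\<chi> i. \<gamma> (idx i) powr (-1/2) * (lift (b (idx i)) \<bullet> w))"

lemma kernel_embedding_eq:
  "(U ** diag (\<lambda>i. \<gamma> (idx i) powr (-1/2)) ** transpose (\<chi> p i. b (idx i) $ p) ** S)
      *v kernel_vector K x x' a = U *v whitening (\<phi> a)"
proof -
  have "transpose (\<chi> p i. b (idx i) $ p) *v v = (\<chi> i. b (idx i) \<bullet> v)" for v
    by (simp add: transpose_def matrix_vector_mult_def inner_vec_def)
  then show ?thesis
    by (simp add: kernel_vector_eq diag_mult inner_lift flip: matrix_vector_mul_assoc)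
qed

text \<open>The matrix \<open>Q\<close> expressing \<open>g\<close> in the lifted \<open>b\<close>
  is orthogonal and mixes only equal eigenvalues. It therefore commutes with the scaling and can be
  absorbed into \<open>U\<close>.\<close>

lemma top_spectral_imp_whitening:
  assumes "top_spectral idx \<Gamma> lam W"
  shows "\<exists>U. orthogonal_matrix U \<and> (\<forall>w. W w = U *v whitening w)"
proof -
  obtain g U where g: "orthonormal_family CARD('d) g"
    and eigen: "\<And>j. j \<in> {1..CARD('d)} \<Longrightarrow> \<Gamma> (g j) = lam j *\<^sub>R g j"
    and U: "orthogonal_matrix U"
    and W: "W = (\<lambda>w. (U ** diag (\<lambda>i. lam (idx i) powr (-1/2))) *v (\<chi> i. g (idx i) \<bullet> w))"
    using assms by (auto simp: top_spectral_def)
  \<comment> \<open>Coefficients between different eigenvalues are 0 by definition, so that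
    commuting with the scaling needs only unfolding.\<close>
  define q where "q i k = (if \<gamma> (idx k) = \<gamma> (idx i) then g (idx i) \<bullet> lift (b (idx k)) else 0)"
    for i k
  have g_eq: "g (idx i) = (\<Sum>k\<in>UNIV. q i k *\<^sub>R lift (b (idx k)))" for i
  proof -
    let ?l = "\<gamma> (idx i)"
    let ?t = "\<lambda>j. (g (idx i) \<bullet> lift (b j)) *\<^sub>R lift (b j)"
    have "g (idx i) = (\<Sum>j | j \<in> {1..2 * CARD('n)} \<and> \<gamma> j = ?l. ?t j)"
      using eigen[OF idx_mem(1)] \<gamma>_pos[of i] \<gamma>_eq_lam[OF idx_mem(1)]
      by (intro \<Gamma>_eigenvector_expansion) auto
    \<comment> \<open>By the gap, no index beyond \<open>d\<close> carries a top eigenvalue.\<close>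
    also have "{j. j \<in> {1..2 * CARD('n)} \<and> \<gamma> j = ?l} = {j \<in> {1..CARD('d)}. \<gamma> j = ?l}"
    proof -
      have "lam CARD('d) \<le> ?l"
        using lam_descending[OF idx_mem(1) card_d] idx_mem(1)[of i] \<gamma>_eq_lam[OF idx_mem(1)] by simp
      then have "j \<le> CARD('d)" if "j \<in> {1..2 * CARD('n)}" "\<gamma> j = ?l" for j
        using \<gamma>_less[of j] that by force
      then show ?thesis
        using d_le by auto
    qed
    also have "(\<Sum>j\<in>\<dots>. ?t j) = (\<Sum>j\<in>{1..CARD('d)}. if \<gamma> j = ?l then ?t j else 0)"
      by (rule sum.inter_filter) simp
    also have "\<dots> = (\<Sum>k\<in>UNIV. if \<gamma> (idx k) = ?l then ?t (idx k) else 0)"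
      by (rule sum.reindex_bij_betw[OF idx, symmetric])
    also have "\<dots> = (\<Sum>k\<in>UNIV. q i k *\<^sub>R lift (b (idx k)))"
      by (rule sum.cong) (simp_all add: q_def)
    finally show ?thesis .
  qed
  define Q where "Q = (\<chi> i k. q i k)"
  have "orthogonal_matrix Q"
  proof (rule orthogonal_matrixI)
    fix i j
    have "(\<Sum>k\<in>UNIV. Q $ i $ k * Q $ j $ k) = g (idx i) \<bullet> g (idx j)"
      by (simp add: g_eq Q_def inner_sum_left inner_sum_right inner_lift_b_idx
          if_distrib[of "\<lambda>t. _ * t"] mult.commute cong: if_cong)
    also have "\<dots> = (if i = j then 1 else 0)"
      using g idx_mem(1) by (simp add: orthonormal_family_def idx_eq_iff)
    finally show "(\<Sum>k\<in>UNIV. Q $ i $ k * Q $ j $ k) = (if i = j then 1 else 0)" .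
  qed
  moreover have "W w = (U ** Q) *v whitening w" for w
  proof -
    have "diag (\<lambda>i. lam (idx i) powr (-1/2)) *v (\<chi> i. g (idx i) \<bullet> w) = Q *v whitening w"
    proof -
      have "lam (idx i) powr (-1/2) * (g (idx i) \<bullet> w) =
          (\<Sum>k\<in>UNIV. q i k * (\<gamma> (idx k) powr (-1/2) * (lift (b (idx k)) \<bullet> w)))" for i
        unfolding g_eq[of i] inner_sum_left sum_distrib_left
        by (rule sum.cong) (auto simp: q_def \<gamma>_eq_lam[OF idx_mem(1)])
      then show ?thesis
        by (simp add: diag_mult vec_eq_iff Q_def matrix_vector_mult_def[of "\<chi> i k. q i k"])
    qed
    then show ?thesis
      by (simp add: W flip: matrix_vector_mul_assoc)
  qed
  ultimately show ?thesis
    using U by (intro exI[of _ "U ** Q"]) (simp add: orthogonal_matrix_mul)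
qed

lemma whitening_top_spectral:
  assumes "orthogonal_matrix U"
  shows "top_spectral idx \<Gamma> lam (\<lambda>w. U *v whitening w)"
  unfolding top_spectral_def
proof (intro conjI ballI exI)
  show "largest_eigenvalues \<Gamma> CARD('d) lam" "\<And>j. j \<in> {1..CARD('d)} \<Longrightarrow> 0 < lam j"
    by (fact largest positive)+
  show "orthonormal_family CARD('d) (\<lambda>j. lift (b j))"
    unfolding orthonormal_family_def
  proof (intro ballI)
    fix i j assume "i \<in> {1..CARD('d)}" "j \<in> {1..CARD('d)}"
    then show "lift (b i) \<bullet> lift (b j) = (if i = j then 1 else 0)"
      using d_le positive[of j] \<gamma>_eq_lam[of j] by (intro inner_lift_b) auto
  qed
  show "\<Gamma> (lift (b j)) = lam j *\<^sub>R lift (b j)" if "j \<in> {1..CARD('d)}" for j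
    using that d_le \<gamma>_eq_lam[of j] by (simp add: \<Gamma>_lift_b)
  show "orthogonal_matrix U"
    by (fact assms)
  show "(\<lambda>w. U *v whitening w) =
      (\<lambda>w. (U ** diag (\<lambda>i. lam (idx i) powr (-1/2))) *v (\<chi> i. lift (b (idx i)) \<bullet> w))"
    by (simp add: diag_mult \<gamma>_eq_lam[OF idx_mem(1)] flip: matrix_vector_mul_assoc)
qed

lemma top_spectral_embeddings:
  "{(\<lambda>a. W (\<phi> a)) | W. top_spectral idx \<Gamma> lam W}
    = {(\<lambda>a. U *v whitening (\<phi> a)) | U. orthogonal_matrix U}" (is "?L = ?R")
proof
  show "?L \<subseteq> ?R"
    using top_spectral_imp_whitening by fastforce
  show "?R \<subseteq> ?L"
  proof
    fix f assume "f \<in> ?R"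
    then obtain U :: "real^'d^'d" where "f = (\<lambda>a. U *v whitening (\<phi> a))" "orthogonal_matrix U"
      by blast
    then show "f \<in> ?L"
      using whitening_top_spectral by (intro CollectI exI[of _ "\<lambda>w. U *v whitening w"]) simp
  qed
qed

end

section \<open>Minimal norm embeddings\<close>

lemma (in rkhs) sum_mem:
  "finite A \<Longrightarrow> (\<And>p. p \<in> A \<Longrightarrow> f p \<in> F) \<Longrightarrow> (\<lambda>a. \<Sum>p\<in>A. f p a) \<in> F"
proof (induction A rule: finite_induct)
  case (insert p A)
  then show ?case
    using add_mem[of "f p" "\<lambda>a. \<Sum>p\<in>A. f p a"] by simp
qed (simp add: zero_mem)

lemma (in rkhs) ip_zero:
  assumes "h \<in> F"
  shows "ip (\<lambda>a. 0) h = 0"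
  using ip_scale[OF zero_mem assms, of 0] by simp

lemma (in rkhs) ip_sum:
  assumes h: "h \<in> F"
  shows "finite A \<Longrightarrow> (\<And>p. p \<in> A \<Longrightarrow> f p \<in> F) \<Longrightarrow>
    ip (\<lambda>a. \<Sum>p\<in>A. f p a) h = (\<Sum>p\<in>A. ip (f p) h)"
proof (induction A rule: finite_induct)
  case (insert p A)
  then show ?case
    using ip_add[of "f p" "\<lambda>a. \<Sum>p\<in>A. f p a" h] sum_mem[of A f] h by simp
qed (simp add: ip_zero h)

lemma (in rkhs) diff_mem:
  assumes "f \<in> F" "g \<in> F"
  shows "(\<lambda>a. f a - g a) \<in> F"
  using add_mem[OF assms(1) scale_mem[OF assms(2), of "-1"]] by simp

locale kernel_sample_rkhs = kernel_sample \<phi> K x x' + rkhs K F ip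
  for \<phi> :: "'x \<Rightarrow> 'h::real_inner" and K and x x' :: "'n::finite \<Rightarrow> 'x" and F ip
begin

definition samples :: "('x \<Rightarrow> real) \<Rightarrow> real^('n + 'n)" where
  "samples h = (\<chi> p. h (point p))"

definition kernel_combination :: "real^('n + 'n) \<Rightarrow> 'x \<Rightarrow> real" where
  "kernel_combination c a = c \<bullet> kernel_vector K x x' a"

lemma kernel_combination_eq: "kernel_combination c = (\<lambda>a. \<Sum>p\<in>UNIV. c $ p * K a (point p))"
  by (simp add: fun_eq_iff kernel_combination_def kernel_vector_eq analysis_def inner_vec_def K
      inner_commute)

lemma kernel_combination_mem: "kernel_combination c \<in> F"
  unfolding kernel_combination_eq by (intro sum_mem scale_mem kernel_mem) simp

lemma ip_kernel_combination:
  assumes "h \<in> F"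
  shows "ip (kernel_combination c) h = c \<bullet> samples h"
proof -
  have "ip (\<lambda>a. K a (point p)) h = h (point p)" for p
    using reproducing[OF assms] ip_commute[OF assms kernel_mem] by simp
  then show ?thesis
    using assms by (simp add: kernel_combination_eq ip_sum ip_scale scale_mem kernel_mem
        samples_def inner_vec_def)
qed

lemma samples_kernel_combination: "samples (kernel_combination c) = Gram *v c"
  by (simp add: vec_eq_iff samples_def kernel_combination_eq matrix_vector_mult_def Gram_nth
      mult.commute)

text \<open>The residual \<open>z\<close> lies in the kernel of \<open>R\<close>, so its kernel
  combination has norm 0 and is the zero function. The reproducing property then makes
  \<open>z\<close> orthogonal to the samples, hence to itself.\<close>

lemma R_S_samples:
  assumes h: "h \<in> F"
  shows "R *v (S *v samples h) = samples h"
proof -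
  define z where "z = samples h - R *v (S *v samples h)"
  have Rz: "R *v z = 0"
    by (simp add: z_def matrix_vector_mult_diff_distrib)
      (metis R_S_R S_R)
  then have "Gram *v z = 0"
    by (metis R_R matrix_vector_mult_0_right)
  then have "ip (kernel_combination z) (kernel_combination z) = 0"
    by (simp add: ip_kernel_combination kernel_combination_mem samples_kernel_combination)
  then have "kernel_combination z = (\<lambda>a. 0)"
    using ip_definite kernel_combination_mem by blast
  then have "z \<bullet> samples h = 0"
    using ip_kernel_combination[OF h, of z] ip_zero[OF h] by simp
  moreover have "z \<bullet> (R *v (S *v samples h)) = 0"
    by (simp add: Rz flip: inner_R)
  ultimately have "z \<bullet> z = 0"
    by (simp add: z_def inner_diff_right)
  then show ?thesis
    by (simp add: z_def)
qed

text \<open>Pythagoras: the orthogonal projection of \<open>h\<close> onto the span of the kernel sections at the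
  sample points is determined by the samples of \<open>h\<close>.\<close>

lemma rkhs_norm_decomposition:
  assumes h: "h \<in> F"
  defines "u \<equiv> S *v samples h"
  defines "r \<equiv> (\<lambda>a. h a - kernel_combination (S *v u) a)"
  shows "r \<in> F" and "ip h h = u \<bullet> u + ip r r"
proof -
  let ?s = "kernel_combination (S *v u)"
  show r: "r \<in> F"
    unfolding r_def by (intro diff_mem h kernel_combination_mem)
  have Ru: "R *v u = samples h"
    by (simp add: u_def R_S_samples h)
  have "samples r = samples h - samples ?s"
    by (simp add: samples_def r_def vec_eq_iff)
  \<comment> \<open>The residual vanishes at the sample points, so it is orthogonal to all kernel
    combinations.\<close>
  then have "samples r = 0"
    by (simp add: samples_kernel_combination Gram_S Ru)
  then have sr: "ip ?s r = 0"
    by (simp add: ip_kernel_combination r)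
  have "S *v (R *v u) = u"
    by (simp only: u_def S_R_S)
  then have ss: "ip ?s ?s = u \<bullet> u"
    by (simp add: ip_kernel_combination kernel_combination_mem samples_kernel_combination Gram_S
        inner_S)
  have split: "h = (\<lambda>a. ?s a + r a)"
    by (simp add: r_def)
  have "ip h h = ip ?s h + ip r h"
    by (subst (1) split) (rule ip_add[OF kernel_combination_mem r h])
  also have "ip ?s h = ip ?s ?s + ip r ?s"
    by (subst ip_commute[OF kernel_combination_mem h], subst split)
      (rule ip_add[OF kernel_combination_mem r kernel_combination_mem])
  also have "ip r h = ip ?s r + ip r r"
    by (subst ip_commute[OF r h], subst split)
      (rule ip_add[OF kernel_combination_mem r r])
  also have "ip r ?s = 0"
    using sr ip_commute[OF kernel_combination_mem r] by simp
  finally show "ip h h = u \<bullet> u + ip r r"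
    by (simp add: sr ss)
qed

lemma loss_eq_0_iff:
  fixes f :: "'x \<Rightarrow> real^'d"
  shows "loss x x' f = 0 \<longleftrightarrow>
    (\<forall>j k. samples (\<lambda>a. f a $ j) \<bullet> (swap_matrix *v samples (\<lambda>a. f a $ k)) = (if j = k then 1 else 0))"
proof -
  have "embedding_cross_corr x x' f $ j $ k =
      samples (\<lambda>a. f a $ j) \<bullet> (swap_matrix *v samples (\<lambda>a. f a $ k))" for j k
    by (simp add: embedding_cross_corr_def outer_mat_def inner_vec_def swap_matrix_mult samples_def
        sum_UNIV_sum sum.distrib sum_divide_distrib[symmetric] add_divide_distrib)
  then show ?thesis
    by (simp add: loss_def vec_eq_iff mat_def)
qed

text \<open>Writing the samples as \<open>R u\<close> turns \<open>J\<close> into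
  \<open>R J R = K_Gamma\<close>.\<close>

lemma loss_eq_0_iff_K_Gamma:
  fixes f :: "'x \<Rightarrow> real^'d"
  assumes "\<And>j. R *v u j = samples (\<lambda>a. f a $ j)"
  shows "loss x x' f = 0 \<longleftrightarrow>
    (\<forall>j k. u j \<bullet> (K_Gamma K x x' *v u k) = (if j = k then 1 else 0))"
  by (simp add: loss_eq_0_iff K_Gamma_eq inner_R flip: assms)

end

context kernel_sample_eigenbasis
begin

lemma inner_b_expansion:
  "u \<bullet> v = (\<Sum>i\<in>{1..2 * CARD('n)}. (u \<bullet> b i) * (v \<bullet> b i))"
  by (subst b_expansion[of u])
    (simp only: inner_sum_left inner_scaleR_left inner_commute[of v])

lemma K_Gamma_inner_b_expansion:
  "u \<bullet> (K_Gamma K x x' *v v) = (\<Sum>i\<in>{1..2 * CARD('n)}. (u \<bullet> b i) * \<gamma> i * (v \<bullet> b i))"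
proof -
  have "(K_Gamma K x x' *v v) \<bullet> b i = \<gamma> i * (v \<bullet> b i)" if "i \<in> {1..2 * CARD('n)}" for i
    by (simp add: inner_matrix_vector_left transpose_K_Gamma b_eigen[OF that])
  then show ?thesis
    by (subst inner_b_expansion) (simp add: mult.assoc)
qed

end

locale kernel_sample_top_rkhs =
  kernel_sample_top \<phi> K x x' b \<gamma> idx lam + kernel_sample_rkhs \<phi> K x x' F ip
  for \<phi> :: "'x \<Rightarrow> 'h::real_inner" and K and x x' :: "'n::finite \<Rightarrow> 'x"
    and b \<gamma> and idx :: "'d::finite \<Rightarrow> nat" and lam F ip
begin

abbreviation feasible :: "('x \<Rightarrow> real^'d) \<Rightarrow> bool" where
  "feasible f \<equiv> (\<forall>j. (\<lambda>a. f a $ j) \<in> F) \<and> loss x x' f = 0"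

lemma b_idx_R_S: "R *v (S *v b (idx i)) = b (idx i)"
  using R_S_eigenvector[OF b_eigen[OF idx_mem(2)]] \<gamma>_pos[of i] by simp

text \<open>The components are kernel combinations with coefficients \<open>S u j\<close>, where
  \<open>u j\<close> has coordinates \<open>U j i / sqrt \<gamma>\<close> in the top eigenvectors.
  Orthonormal rows of \<open>U\<close> give the constraint, unit columns the norm.\<close>

lemma whitening_feasible:
  assumes U: "orthogonal_matrix U"
  defines "f \<equiv> (\<lambda>a. U *v whitening (\<phi> a))"
  shows "feasible f"
    and "(\<Sum>j\<in>UNIV. ip (\<lambda>a. f a $ j) (\<lambda>a. f a $ j)) = (\<Sum>i\<in>UNIV. 1 / \<gamma> (idx i))"
proof -
  define t where "t i = \<gamma> (idx i) powr (-1/2)" for i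
  have t: "t i * t i = 1 / \<gamma> (idx i)" for i
    unfolding t_def powr_minus_half[OF \<gamma>_pos] using \<gamma>_pos[of i] by simp
  define u where "u j = (\<Sum>i\<in>UNIV. (U $ j $ i * t i) *\<^sub>R b (idx i))" for j
  have f_eq: "(\<lambda>a. f a $ j) = kernel_combination (S *v u j)" for j
    by (simp add: fun_eq_iff f_def matrix_vector_mult_def[of U] kernel_combination_def inner_S
        kernel_vector_eq u_def inner_sum_left inner_lift t_def mult.assoc)
  have RSu: "R *v (S *v u j) = u j" for j
    by (simp add: u_def vec.sum matrix_vector_mult_scaleR b_idx_R_S)
  have Ru: "R *v u j = samples (\<lambda>a. f a $ j)" for j
    by (simp add: f_eq samples_kernel_combination Gram_S)
  have ub: "u j \<bullet> b (idx i) = U $ j $ i * t i" for i j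
    by (simp add: u_def inner_sum_left inner_b[OF idx_mem(2) idx_mem(2)] idx_eq_iff
        if_distrib[of "\<lambda>t. _ * t"] cong: if_cong)
  have "u j \<bullet> (K_Gamma K x x' *v u k) = (if j = k then 1 else 0)" for j k
  proof -
    have "K_Gamma K x x' *v u k = (\<Sum>i\<in>UNIV. (U $ k $ i * t i * \<gamma> (idx i)) *\<^sub>R b (idx i))"
      by (simp add: u_def vec.sum matrix_vector_mult_scaleR b_eigen[OF idx_mem(2)])
    then have "u j \<bullet> (K_Gamma K x x' *v u k)
        = (\<Sum>i\<in>UNIV. U $ j $ i * U $ k $ i * (t i * t i * \<gamma> (idx i)))"
      by (simp add: inner_sum_right ub mult_ac)
    also have "\<dots> = (if j = k then 1 else 0)"
      using \<gamma>_pos by (simp add: t less_imp_neq[symmetric] orthogonal_matrix_rows[OF U])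
    finally show ?thesis .
  qed
  then have "loss x x' f = 0"
    by (subst loss_eq_0_iff_K_Gamma[of u, OF Ru]) blast
  then show "feasible f"
    by (simp add: f_eq kernel_combination_mem)
  have "ip (\<lambda>a. f a $ j) (\<lambda>a. f a $ j) = (\<Sum>i\<in>UNIV. (U $ j $ i * U $ j $ i) * (1 / \<gamma> (idx i)))" for j
  proof -
    have "ip (\<lambda>a. f a $ j) (\<lambda>a. f a $ j) = u j \<bullet> u j"
      by (simp add: f_eq ip_kernel_combination kernel_combination_mem samples_kernel_combination
          Gram_S inner_S S_R RSu)
    also have "\<dots> = (\<Sum>i\<in>UNIV. (U $ j $ i * t i) * (u j \<bullet> b (idx i)))"
      by (subst (2) u_def) (simp add: inner_sum_right)
    finally show ?thesis
      by (simp add: ub mult_ac flip: t)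
  qed
  then show "(\<Sum>j\<in>UNIV. ip (\<lambda>a. f a $ j) (\<lambda>a. f a $ j)) = (\<Sum>i\<in>UNIV. 1 / \<gamma> (idx i))"
    by (simp only:) (subst sum.swap, simp only: sum_distrib_right[symmetric]
        orthogonal_matrix_columns[OF U], simp)
qed

text \<open>Apply \<open>trace_minimum\<close> to the coordinates of the \<open>u j\<close> in the
  eigenbasis. Equality kills both the residuals \<open>r j\<close> and the coordinates outside the
  top \<open>d\<close>.\<close>

lemma feasible_norm:
  assumes f: "feasible f"
  shows "(\<Sum>i\<in>UNIV. 1 / \<gamma> (idx i)) \<le> (\<Sum>j\<in>UNIV. ip (\<lambda>a. f a $ j) (\<lambda>a. f a $ j))"
    and "(\<Sum>j\<in>UNIV. ip (\<lambda>a. f a $ j) (\<lambda>a. f a $ j)) = (\<Sum>i\<in>UNIV. 1 / \<gamma> (idx i)) \<Longrightarrow>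
      \<exists>U. orthogonal_matrix U \<and> f = (\<lambda>a. U *v whitening (\<phi> a))"
proof -
  have mem: "(\<lambda>a. f a $ j) \<in> F" for j
    using f by blast
  define u where "u j = S *v samples (\<lambda>a. f a $ j)" for j
  define r where "r j = (\<lambda>a. f a $ j - kernel_combination (S *v u j) a)" for j
  have Ru: "R *v u j = samples (\<lambda>a. f a $ j)" for j
    by (simp add: u_def R_S_samples mem)
  have r: "r j \<in> F" and norm: "ip (\<lambda>a. f a $ j) (\<lambda>a. f a $ j) = u j \<bullet> u j + ip (r j) (r j)" for j
    using rkhs_norm_decomposition[OF mem, of j] by (simp_all add: u_def r_def)
  have constraint: "u j \<bullet> (K_Gamma K x x' *v u k) = (if j = k then 1 else 0)" for j k
    using f loss_eq_0_iff_K_Gamma[of u, OF Ru] by blast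
  \<comment> \<open>\<open>trace_minimum\<close> is indexed by finite types, so the eigenbasis is
    renumbered by \<open>'n + 'n\<close>.\<close>
  obtain \<beta> :: "'n + 'n \<Rightarrow> nat" where \<beta>: "bij_betw \<beta> UNIV {1..2 * CARD('n)}"
    using finite_same_card_bij[of "UNIV :: ('n + 'n) set" "{1..2 * CARD('n)}"] by auto
  note reindex = sum.reindex_bij_betw[OF \<beta>]
  have \<beta>_mem: "\<beta> p \<in> {1..2 * CARD('n)}" for p
    using bij_betwE[OF \<beta>] by blast
  define A where "A j p = u j \<bullet> b (\<beta> p)" for j p
  define T where "T = {p. \<beta> p \<le> CARD('d)}"
  have "\<beta> ` T = {1..CARD('d)}"
  proof
    show "\<beta> ` T \<subseteq> {1..CARD('d)}"
      using \<beta>_mem by (auto simp: T_def)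
    show "{1..CARD('d)} \<subseteq> \<beta> ` T"
    proof
      fix j assume j: "j \<in> {1..CARD('d)}"
      then have "j \<in> range \<beta>"
        using \<beta> d_le by (auto simp: bij_betw_def)
      then show "j \<in> \<beta> ` T"
        using j by (auto simp: T_def)
    qed
  qed
  then have \<beta>T: "bij_betw \<beta> T {1..CARD('d)}"
    using \<beta> by (metis bij_betw_def inj_on_subset subset_UNIV)
  have "(\<Sum>p\<in>T. 1 / \<gamma> (\<beta> p)) = (\<Sum>i\<in>{1..CARD('d)}. 1 / \<gamma> i)"
    by (rule sum.reindex_bij_betw[OF \<beta>T])
  also have "\<dots> = (\<Sum>i\<in>UNIV. 1 / \<gamma> (idx i))"
    by (rule sum.reindex_bij_betw[OF idx, symmetric])
  finally have T_sum: "(\<Sum>p\<in>T. 1 / \<gamma> (\<beta> p)) = (\<Sum>i\<in>UNIV. 1 / \<gamma> (idx i))" .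
  have T_ge: "lam CARD('d) \<le> \<gamma> (\<beta> p)" if "p \<in> T" for p
    using bij_betwE[OF \<beta>T] that \<gamma>_eq_lam[of "\<beta> p"] lam_descending[OF _ card_d, of "\<beta> p"] by auto
  have card_T: "card T = CARD('d)"
    using bij_betw_same_card[OF \<beta>T] by simp
  have T_pos: "0 < \<gamma> (\<beta> p)" if "p \<in> T" for p
    using T_ge[OF that] positive[OF card_d] by simp
  have T_gap: "\<gamma> (\<beta> q) < \<gamma> (\<beta> p)" if "p \<in> T" "q \<notin> T" for p q
    using T_ge[OF that(1)] \<gamma>_less[of "\<beta> q"] \<beta>_mem[of q] that(2) by (simp add: T_def)
  have A: "(\<Sum>p\<in>UNIV. A j p * \<gamma> (\<beta> p) * A k p) = (if j = k then 1 else 0)" for j k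
    unfolding A_def using reindex[of "\<lambda>i. (u j \<bullet> b i) * \<gamma> i * (u k \<bullet> b i)"]
    by (simp only: constraint flip: K_Gamma_inner_b_expansion)
  have minimum: "(\<Sum>p\<in>T. 1 / \<gamma> (\<beta> p)) \<le> (\<Sum>j\<in>UNIV. \<Sum>p\<in>UNIV. (A j p)\<^sup>2)"
    by (rule trace_minimum[OF card_T T_pos T_gap A])
  have minimum_eq: "A j p = 0"
    if "(\<Sum>j\<in>UNIV. \<Sum>p\<in>UNIV. (A j p)\<^sup>2) = (\<Sum>p\<in>T. 1 / \<gamma> (\<beta> p))" "p \<notin> T" for j p
    by (rule trace_minimum(2)[OF card_T T_pos T_gap A that])
  have u_A: "(\<Sum>j\<in>UNIV. u j \<bullet> u j) = (\<Sum>j\<in>UNIV. \<Sum>p\<in>UNIV. (A j p)\<^sup>2)"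
    unfolding A_def
    by (rule sum.cong[OF refl], subst inner_b_expansion, subst reindex[symmetric])
      (simp add: power2_eq_square)
  have norm_sum: "(\<Sum>j\<in>UNIV. ip (\<lambda>a. f a $ j) (\<lambda>a. f a $ j))
      = (\<Sum>j\<in>UNIV. \<Sum>p\<in>UNIV. (A j p)\<^sup>2) + (\<Sum>j\<in>UNIV. ip (r j) (r j))"
    by (simp add: norm sum.distrib u_A)
  have r_nonneg: "0 \<le> (\<Sum>j\<in>UNIV. ip (r j) (r j))"
    by (intro sum_nonneg ip_nonneg r)
  show "(\<Sum>i\<in>UNIV. 1 / \<gamma> (idx i)) \<le> (\<Sum>j\<in>UNIV. ip (\<lambda>a. f a $ j) (\<lambda>a. f a $ j))"
    using minimum r_nonneg by (simp add: norm_sum T_sum)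
  assume eq: "(\<Sum>j\<in>UNIV. ip (\<lambda>a. f a $ j) (\<lambda>a. f a $ j)) = (\<Sum>i\<in>UNIV. 1 / \<gamma> (idx i))"
  then have A_sum: "(\<Sum>j\<in>UNIV. \<Sum>p\<in>UNIV. (A j p)\<^sup>2) = (\<Sum>p\<in>T. 1 / \<gamma> (\<beta> p))"
    and r_sum: "(\<Sum>j\<in>UNIV. ip (r j) (r j)) = 0"
    using minimum r_nonneg by (simp_all add: norm_sum T_sum)
  have "ip (r j) (r j) = 0" for j
    using r_sum by (simp add: sum_nonneg_eq_0_iff ip_nonneg r)
  then have "r j = (\<lambda>a. 0)" for j
    using ip_definite r by blast
  then have f_eq: "f a $ j = u j \<bullet> (S *v analysis (\<phi> a))" for a j
    by (simp add: r_def fun_eq_iff kernel_combination_def inner_S kernel_vector_eq)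
  have ub_zero: "u j \<bullet> b i = 0" if i: "i \<in> {1..2 * CARD('n)}" "i \<notin> {1..CARD('d)}" for i j
  proof -
    obtain p where "i = \<beta> p"
      using i(1) bij_betw_imp_surj_on[OF \<beta>] by blast
    then show ?thesis
      using minimum_eq[OF A_sum, of p j] i by (auto simp: T_def A_def)
  qed
  have top: "(\<Sum>i\<in>{1..2 * CARD('n)}. h i) = (\<Sum>i\<in>UNIV. h (idx i))"
    if "\<And>i. \<lbrakk>i \<in> {1..2 * CARD('n)}; i \<notin> {1..CARD('d)}\<rbrakk> \<Longrightarrow> h i = 0" for h :: "nat \<Rightarrow> real"
  proof -
    have "(\<Sum>i\<in>{1..2 * CARD('n)}. h i) = (\<Sum>i\<in>{1..CARD('d)}. h i)"
      using that d_le by (intro sum.mono_neutral_right) auto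
    then show ?thesis
      by (simp only: sum.reindex_bij_betw[OF idx])
  qed
  \<comment> \<open>Undoes the scaling in \<open>whitening\<close>; the constraint
    \<open>A diag(\<gamma>) A\<^sup>T = I\<close> says exactly that \<open>U\<close> is
    orthogonal.\<close>
  define U where "U = (\<chi> j i. (u j \<bullet> b (idx i)) * sqrt (\<gamma> (idx i)))"
  have "orthogonal_matrix U"
  proof (rule orthogonal_matrixI)
    fix j k
    have "(\<Sum>i\<in>UNIV. U $ j $ i * U $ k $ i)
        = (\<Sum>i\<in>UNIV. (u j \<bullet> b (idx i)) * \<gamma> (idx i) * (u k \<bullet> b (idx i)))"
    proof (rule sum.cong[OF refl])
      fix i
      have "sqrt (\<gamma> (idx i)) * sqrt (\<gamma> (idx i)) = \<gamma> (idx i)"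
        using \<gamma>_pos[of i] by simp
      then show "U $ j $ i * U $ k $ i = (u j \<bullet> b (idx i)) * \<gamma> (idx i) * (u k \<bullet> b (idx i))"
        by (simp add: U_def algebra_simps)
    qed
    also have "\<dots> = u j \<bullet> (K_Gamma K x x' *v u k)"
      unfolding K_Gamma_inner_b_expansion by (rule top[symmetric]) (simp add: ub_zero)
    finally show "(\<Sum>i\<in>UNIV. U $ j $ i * U $ k $ i) = (if j = k then 1 else 0)"
      by (simp only: constraint)
  qed
  moreover have "f a = U *v whitening (\<phi> a)" for a
  proof -
    have "f a $ j = (U *v whitening (\<phi> a)) $ j" for j
    proof -
      have "f a $ j = (\<Sum>i\<in>UNIV. (u j \<bullet> b (idx i)) * ((S *v analysis (\<phi> a)) \<bullet> b (idx i)))"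
        unfolding f_eq by (subst inner_b_expansion, rule top) (simp add: ub_zero)
      also have "\<dots> = (\<Sum>i\<in>UNIV. U $ j $ i * whitening (\<phi> a) $ i)"
      proof (rule sum.cong[OF refl])
        fix i
        let ?c = "u j \<bullet> b (idx i)" and ?y = "(S *v analysis (\<phi> a)) \<bullet> b (idx i)"
        have "U $ j $ i * whitening (\<phi> a) $ i = (?c * sqrt (\<gamma> (idx i))) * (1 / sqrt (\<gamma> (idx i)) * ?y)"
          unfolding U_def vec_lambda_beta powr_minus_half[OF \<gamma>_pos] inner_lift
          by (simp only: inner_commute)
        then show "?c * ?y = U $ j $ i * whitening (\<phi> a) $ i"
          using \<gamma>_pos[of i] by simp
      qed
      finally show ?thesis
        by (simp add: matrix_vector_mult_def[of U])
    qed
    then show ?thesis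
      by (simp add: vec_eq_iff)
  qed
  ultimately show "\<exists>U. orthogonal_matrix U \<and> f = (\<lambda>a. U *v whitening (\<phi> a))"
    by blast
qed

lemma minimizers:
  "{f. is_arg_min (vector_rkhs_norm ip) feasible f}
    = {(\<lambda>a. U *v whitening (\<phi> a)) | U. orthogonal_matrix U}"
proof (intro set_eqI iffI)
  fix f assume "f \<in> {(\<lambda>a. U *v whitening (\<phi> a)) | U. orthogonal_matrix U}"
  then obtain U where U: "orthogonal_matrix U" and f: "f = (\<lambda>a. U *v whitening (\<phi> a))"
    by blast
  have "\<not> vector_rkhs_norm ip g < vector_rkhs_norm ip f" if "feasible g" for g
    using feasible_norm(1)[OF that] whitening_feasible(2)[OF U]
    by (simp add: vector_rkhs_norm_def f not_less)
  then show "f \<in> {f. is_arg_min (vector_rkhs_norm ip) feasible f}"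
    using whitening_feasible(1)[OF U] by (auto simp: is_arg_min_def f)
next
  fix f assume "f \<in> {f. is_arg_min (vector_rkhs_norm ip) feasible f}"
  then have f: "feasible f"
    and min: "\<And>g. feasible g \<Longrightarrow> vector_rkhs_norm ip f \<le> vector_rkhs_norm ip g"
    by (auto simp: is_arg_min_def not_less)
  \<comment> \<open>The identity supplies a feasible competitor that attains the lower
    bound.\<close>
  have I: "orthogonal_matrix (mat 1 :: real^'d^'d)"
    by (rule orthogonal_matrix_id)
  have "(\<Sum>j\<in>UNIV. ip (\<lambda>a. f a $ j) (\<lambda>a. f a $ j)) \<le> (\<Sum>i\<in>UNIV. 1 / \<gamma> (idx i))"
    using min[OF whitening_feasible(1)[OF I]] whitening_feasible(2)[OF I]
    by (simp add: vector_rkhs_norm_def)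
  then show "f \<in> {(\<lambda>a. U *v whitening (\<phi> a)) | U. orthogonal_matrix U}"
    using feasible_norm[OF f] by auto
qed

end

theorem proposition5p1:
  fixes \<phi> :: "'x \<Rightarrow> 'h::{real_inner, complete_space}"
    and K :: "'x \<Rightarrow> 'x \<Rightarrow> real"
    and x x' :: "'n::finite \<Rightarrow> 'x"
    and \<Gamma> :: "'h \<Rightarrow> 'h"
    and \<gamma> lam :: "nat \<Rightarrow> real"
    and b :: "nat \<Rightarrow> real^('n + 'n)"
    and idx :: "'d::finite \<Rightarrow> nat"
    and F :: "('x \<Rightarrow> real) set"
    and ip :: "('x \<Rightarrow> real) \<Rightarrow> ('x \<Rightarrow> real) \<Rightarrow> real"
  assumes K: "\<And>y z. K y z = \<phi> y \<bullet> \<phi> z"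
    and Gamma: "\<Gamma> = feature_cross_corr \<phi> x x'"
    and b_orthonormal: "orthonormal_family (2 * CARD('n)) b"
    and b_eigen: "\<And>j. j \<in> {1..2 * CARD('n)} \<Longrightarrow> K_Gamma K x x' *v b j = \<gamma> j *\<^sub>R b j"
    and gamma_descending:
      "\<And>i j. \<lbrakk>i \<in> {1..2 * CARD('n)}; j \<in> {1..2 * CARD('n)}; i \<le> j\<rbrakk> \<Longrightarrow> \<gamma> j \<le> \<gamma> i"
    and idx: "bij_betw idx UNIV {1..CARD('d)}"
    and largest: "largest_eigenvalues \<Gamma> CARD('d) lam"
    and positive: "\<And>j. j \<in> {1..CARD('d)} \<Longrightarrow> 0 < lam j"
    and gap: "\<And>mu. largest_eigenvalues \<Gamma> (CARD('d) + 1) mu \<Longrightarrow> mu (CARD('d) + 1) < mu CARD('d)"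
    and rkhs: "rkhs K F ip"
  shows
   "({l. l \<noteq> 0 \<and> eigenvalue ((*v) (K_Gamma K x x')) l} = {l. l \<noteq> 0 \<and> eigenvalue \<Gamma> l}) \<and>
    ({(\<lambda>a. W (\<phi> a)) | W :: 'h \<Rightarrow> real^'d. top_spectral idx \<Gamma> lam W} =
         {(\<lambda>a. (U ** diag (\<lambda>i. \<gamma> (idx i) powr (-1/2)) ** transpose (\<chi> p i. b (idx i) $ p)
                  ** inverse_sqrt (K_tilde K x x')) *v kernel_vector K x x' a)
           | U :: real^'d^'d. orthogonal_matrix U}) \<and>
    ({(\<lambda>a. W (\<phi> a)) | W :: 'h \<Rightarrow> real^'d. top_spectral idx \<Gamma> lam W} =
         {f. is_arg_min (vector_rkhs_norm ip)
               (\<lambda>f. (\<forall>j. (\<lambda>a. f a $ j) \<in> F) \<and> loss x x' f = 0) f})"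
proof -
  interpret rkhs K F ip
    by (fact rkhs)
  interpret kernel_sample_top_rkhs \<phi> K x x' b \<gamma> idx lam F ip
    by unfold_locales
      (use K b_orthonormal b_eigen gamma_descending idx largest positive gap in
        \<open>auto simp: Gamma\<close>)
  show ?thesis
    unfolding Gamma
  proof (intro conjI)
    show "{l. l \<noteq> 0 \<and> eigenvalue ((*v) (K_Gamma K x x')) l} =
        {l. l \<noteq> 0 \<and> eigenvalue (feature_cross_corr \<phi> x x') l}"
      using eigenvalue_K_Gamma_iff by blast
  \<comment> \<open>Both remaining equations reduce to the set of orthogonal images of the
    \<open>whitening\<close> embedding.\<close>
  qed (simp_all only: kernel_embedding_eq top_spectral_embeddings minimizers)
qed

end
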